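(* Let $R$ be a commutative ring, let $s$ be a positive integer, and let $F\in\mathcal{P}_{s,R}$ be a homogeneous strict polynomial functor of weight $s$. If $\deg(F)<s$, then the values $F(M)$, for $M$ a finitely generated projective $R$-module, considered as abelian groups, are torsion groups.
   Context: Let $\mathrm{P}_R$ be the category of finitely generated projective $R$-modules. For an integer $s\ge 0$, the Schur category $\Gamma^s\mathrm{P}_R$ is the $R$-linear category with the same objects as $\mathrm{P}_R$, with morphisms $\mathrm{Hom}_{\Gamma^s\mathrm{P}_R}(M,N)=\mathrm{Hom}_{\mathfrak{S}_s}(M^{\otimes s},N^{\otimes s})\simeq\Gamma^s(\mathrm{Hom}_R(M,N))$ (the $\mathfrak{S}_s$-equivariant $R$-linear maps, $\mathfrak{S}_s$ permuting tensor factors; $M^{\otimes 0}=R$), and composition of equivariant maps. The category $\mathcal{P}_{s,R}$ of homogeneous strict polynomial functors of weight $s$ is the abelian category of $R$-linear functors $\Gamma^s\mathrm{P}_R\to R\text{-Mod}$. Each $F\in\mathcal{P}_{s,R}$ has an underlying ordinary functor $\mathrm{P}_R\to R\text{-Mod}$, obtained by precomposing with the functor $\mathrm{P}_R\to\Gamma^s\mathrm{P}_R$ which is the identity on objects and $f\mapsto f^{\otimes s}$ on morphisms. Degree (Eilenberg–Mac Lane). For a functor $F:\mathcal{A}\to\mathcal{B}$ from an additive to an abelian category, the cross effects are the natural direct summands defined inductively by $\mathrm{cr}_1F(X)\oplus F(0)=F(X)$ and $\mathrm{cr}_dF(X_1,\dots,X_d)\oplus \mathrm{cr}_{d-1}F(X_1,X_3,\dots,X_d)\oplus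 \mathrm{cr}_{d-1}F(X_2,X_3,\dots,X_d)=\mathrm{cr}_{d-1}F(X_1\oplus X_2,X_3,\dots,X_d)$. $F$ has degree $\le d$ if $\mathrm{cr}_{d+1}F=0$, and degree $d$ if moreover $\mathrm{cr}_dF\neq 0$ (nonzero constant functors have degree $0$); the zero functor has degree $-\infty$. The degree $\deg(F)$ of a strict polynomial functor is the degree of its underlying ordinary functor. *)

theory Defs
  imports
    "HOL-Algebra.Module"
    "HOL-Algebra.AbelCoset"
    "HOL-Combinatorics.Permutations"
    "HOL-Library.Extended"
begin

definition linear_map ::
  "('r, 'x) ring_scheme \<Rightarrow> ('r, 'a) module \<Rightarrow> ('r, 'b) module \<Rightarrow> ('a \<Rightarrow> 'b) \<Rightarrow> bool" where
  "linear_map R M N f \<longleftrightarrow>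
     f \<in> hom (add_monoid M) (add_monoid N) \<and>
     (\<forall>r\<in>carrier R. \<forall>x\<in>carrier M. f (r \<odot>\<^bsub>M\<^esub> x) = r \<odot>\<^bsub>N\<^esub> f x)"

text \<open>Elements of a Hom set are extensional, so that equality of morphisms is equality on the
  carrier.\<close>

definition lin_hom ::
  "('r, 'x) ring_scheme \<Rightarrow> ('r, 'a) module \<Rightarrow> ('r, 'b) module \<Rightarrow> ('a \<Rightarrow> 'b) set" where
  "lin_hom R M N = {f \<in> extensional (carrier M). linear_map R M N f}"

definition id_map :: "('r, 'a) module \<Rightarrow> 'a \<Rightarrow> 'a" where
  "id_map M = (\<lambda>x\<in>carrier M. x)"

text \<open>The fields \<open>mult\<close> and \<open>one\<close> of a module record carry no information and are left undefined
  in all constructions below.\<close>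

definition hom_module ::
  "('r, 'x) ring_scheme \<Rightarrow> ('r, 'a) module \<Rightarrow> ('r, 'b) module \<Rightarrow> ('r, 'a \<Rightarrow> 'b) module" where
  "hom_module R M N =
     \<lparr>carrier = lin_hom R M N, monoid.mult = undefined, monoid.one = undefined,
      zero = (\<lambda>x\<in>carrier M. \<zero>\<^bsub>N\<^esub>),
      add = (\<lambda>f g. \<lambda>x\<in>carrier M. f x \<oplus>\<^bsub>N\<^esub> g x),
      smult = (\<lambda>r f. \<lambda>x\<in>carrier M. r \<odot>\<^bsub>N\<^esub> f x)\<rparr>"

definition free_module :: "('r, 'x) ring_scheme \<Rightarrow> 'i set \<Rightarrow> ('r, 'i \<Rightarrow> 'r) module" where
  "free_module R I =
     \<lparr>carrier = {u \<in> I \<rightarrow>\<^sub>E carrier R. finite {i \<in> I. u i \<noteq> \<zero>\<^bsub>R\<^esub>}},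
      monoid.mult = undefined, monoid.one = undefined,
      zero = (\<lambda>i\<in>I. \<zero>\<^bsub>R\<^esub>),
      add = (\<lambda>u v. \<lambda>i\<in>I. u i \<oplus>\<^bsub>R\<^esub> v i),
      smult = (\<lambda>r u. \<lambda>i\<in>I. r \<otimes>\<^bsub>R\<^esub> u i)\<rparr>"

definition basis_vec :: "('r, 'x) ring_scheme \<Rightarrow> 'i set \<Rightarrow> 'i \<Rightarrow> 'i \<Rightarrow> 'r" where
  "basis_vec R I j = (\<lambda>i\<in>I. if i = j then \<one>\<^bsub>R\<^esub> else \<zero>\<^bsub>R\<^esub>)"

definition submodule_span ::
  "('r, 'x) ring_scheme \<Rightarrow> ('r, 'a) module \<Rightarrow> 'a set \<Rightarrow> 'a set" where
  "submodule_span R M S = \<Inter>{K. submodule K R M \<and> S \<subseteq> K}"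

definition quotient_module :: "('r, 'a) module \<Rightarrow> 'a set \<Rightarrow> ('r, 'a set) module" where
  "quotient_module M K =
     \<lparr>carrier = a_rcosets\<^bsub>M\<^esub> K, monoid.mult = undefined, monoid.one = undefined,
      zero = K,
      add = set_add M,
      smult = (\<lambda>r C. \<Union>c\<in>C. K +>\<^bsub>M\<^esub> (r \<odot>\<^bsub>M\<^esub> c))\<rparr>"

text \<open>The objects are the finitely generated projective \<open>R\<close>-modules whose carrier is a set of
  elements of one type \<open>'m\<close>, which serves as the universe. If there are injections
  \<open>'m \<times> 'm \<Rightarrow> 'm\<close> and \<open>carrier R \<rightarrow> 'm\<close>, then every finitely generated projective \<open>R\<close>-module, on
  whatever type, is isomorphic to an object: such an \<open>'m\<close> is infinite (unless it has only one
  element, and then \<open>R = 0\<close>), and all the modules \<open>R\<^sup>n\<close> embed into it.\<close>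

definition finitely_generated :: "('r, 'x) ring_scheme \<Rightarrow> ('r, 'm) module \<Rightarrow> bool" where
  "finitely_generated R M \<longleftrightarrow>
     (\<exists>A. finite A \<and> A \<subseteq> carrier M \<and> submodule_span R M A = carrier M)"

text \<open>Projective means being a direct summand of a free module. Bases indexed by subsets of \<open>'m\<close>
  suffice, because \<open>M\<close> is a quotient of the free module on \<open>carrier M\<close>.\<close>

definition projective :: "('r, 'x) ring_scheme \<Rightarrow> ('r, 'm) module \<Rightarrow> bool" where
  "projective R M \<longleftrightarrow>
     (\<exists>(I :: 'm set) i p. i \<in> lin_hom R M (free_module R I) \<and> p \<in> lin_hom R (free_module R I) M \<and>
        compose (carrier M) p i = id_map M)"

definition fg_projective :: "('r, 'x) ring_scheme \<Rightarrow> ('r, 'm) module set" where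
  "fg_projective R = {M. module R M \<and> finitely_generated R M \<and> projective R M}"

definition zero_module :: "('r, 'm) module" where
  "zero_module =
     \<lparr>carrier = {undefined}, monoid.mult = undefined, monoid.one = undefined, zero = undefined,
      add = (\<lambda>_ _. undefined), smult = (\<lambda>_ _. undefined)\<rparr>"

definition zero_map :: "('r, 'm) module \<Rightarrow> 'm \<Rightarrow> 'm" where
  "zero_map M = (\<lambda>x\<in>carrier M. undefined)"

text \<open>Direct sums are formed inside the universe by coding pairs. All of this is meaningful
  only if \<open>'m\<close> admits an injective pairing.\<close>

definition pair_code :: "'m \<times> 'm \<Rightarrow> 'm" where
  "pair_code = (SOME c. inj c)"

definition code_fst :: "'m \<Rightarrow> 'm" where
  "code_fst z = fst (inv_into UNIV pair_code z)"

definition code_snd :: "'m \<Rightarrow> 'm" where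
  "code_snd z = snd (inv_into UNIV pair_code z)"

definition dsum :: "('r, 'm) module \<Rightarrow> ('r, 'm) module \<Rightarrow> ('r, 'm) module" where
  "dsum M N =
     \<lparr>carrier = pair_code ` (carrier M \<times> carrier N), monoid.mult = undefined, monoid.one = undefined,
      zero = pair_code (\<zero>\<^bsub>M\<^esub>, \<zero>\<^bsub>N\<^esub>),
      add = (\<lambda>z w. pair_code (code_fst z \<oplus>\<^bsub>M\<^esub> code_fst w, code_snd z \<oplus>\<^bsub>N\<^esub> code_snd w)),
      smult = (\<lambda>r z. pair_code (r \<odot>\<^bsub>M\<^esub> code_fst z, r \<odot>\<^bsub>N\<^esub> code_snd z))\<rparr>"

definition dsum_fst :: "('r, 'm) module \<Rightarrow> ('r, 'm) module \<Rightarrow> 'm \<Rightarrow> 'm" where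
  "dsum_fst M N = (\<lambda>z\<in>carrier (dsum M N). code_fst z)"

definition dsum_snd :: "('r, 'm) module \<Rightarrow> ('r, 'm) module \<Rightarrow> 'm \<Rightarrow> 'm" where
  "dsum_snd M N = (\<lambda>z\<in>carrier (dsum M N). code_snd z)"

definition dsum_map ::
  "('r, 'm) module \<Rightarrow> ('r, 'm) module \<Rightarrow> ('m \<Rightarrow> 'm) \<Rightarrow> ('m \<Rightarrow> 'm) \<Rightarrow> 'm \<Rightarrow> 'm" where
  "dsum_map M N f g = (\<lambda>z\<in>carrier (dsum M N). pair_code (f (code_fst z), g (code_snd z)))"

text \<open>\<open>tensor_power R s M\<close> is the free module on the \<open>s\<close>-tuples of elements of \<open>M\<close> modulo the
  multilinearity relations. For \<open>s = 0\<close> there is one tuple and no relation, which gives \<open>R\<close>.\<close>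

definition tuples :: "nat \<Rightarrow> ('r, 'm) module \<Rightarrow> (nat \<Rightarrow> 'm) set" where
  "tuples s M = {..<s} \<rightarrow>\<^sub>E carrier M"

definition tensor_relations ::
  "('r, 'x) ring_scheme \<Rightarrow> nat \<Rightarrow> ('r, 'm) module \<Rightarrow> ((nat \<Rightarrow> 'm) \<Rightarrow> 'r) set" where
  "tensor_relations R s M =
     (let L = free_module R (tuples s M); e = basis_vec R (tuples s M) in
       {e (x(i := a \<oplus>\<^bsub>M\<^esub> b)) \<ominus>\<^bsub>L\<^esub> (e (x(i := a)) \<oplus>\<^bsub>L\<^esub> e (x(i := b))) | x i a b.
          x \<in> tuples s M \<and> i < s \<and> a \<in> carrier M \<and> b \<in> carrier M} \<union>
       {e (x(i := r \<odot>\<^bsub>M\<^esub> a)) \<ominus>\<^bsub>L\<^esub> r \<odot>\<^bsub>L\<^esub> e (x(i := a)) | x i r a.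
          x \<in> tuples s M \<and> i < s \<and> r \<in> carrier R \<and> a \<in> carrier M})"

definition tensor_kernel ::
  "('r, 'x) ring_scheme \<Rightarrow> nat \<Rightarrow> ('r, 'm) module \<Rightarrow> ((nat \<Rightarrow> 'm) \<Rightarrow> 'r) set" where
  "tensor_kernel R s M = submodule_span R (free_module R (tuples s M)) (tensor_relations R s M)"

definition tensor_power ::
  "('r, 'x) ring_scheme \<Rightarrow> nat \<Rightarrow> ('r, 'm) module \<Rightarrow> ('r, ((nat \<Rightarrow> 'm) \<Rightarrow> 'r) set) module" where
  "tensor_power R s M = quotient_module (free_module R (tuples s M)) (tensor_kernel R s M)"

definition pure_tensor ::
  "('r, 'x) ring_scheme \<Rightarrow> nat \<Rightarrow> ('r, 'm) module \<Rightarrow> (nat \<Rightarrow> 'm) \<Rightarrow> ((nat \<Rightarrow> 'm) \<Rightarrow> 'r) set" where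
  "pure_tensor R s M x =
     tensor_kernel R s M +>\<^bsub>free_module R (tuples s M)\<^esub> basis_vec R (tuples s M) x"

definition tensor_lift ::
  "('r, 'x) ring_scheme \<Rightarrow> nat \<Rightarrow> ('r, 'm) module \<Rightarrow> ('r, 'p) module \<Rightarrow>
   ((nat \<Rightarrow> 'm) \<Rightarrow> 'p) \<Rightarrow> ((nat \<Rightarrow> 'm) \<Rightarrow> 'r) set \<Rightarrow> 'p" where
  "tensor_lift R s M P \<phi> =
     (THE h. h \<in> lin_hom R (tensor_power R s M) P \<and>
        (\<forall>x\<in>tuples s M. h (pure_tensor R s M x) = \<phi> x))"

definition tensor_map ::
  "('r, 'x) ring_scheme \<Rightarrow> nat \<Rightarrow> ('r, 'm) module \<Rightarrow> ('r, 'n) module \<Rightarrow> ('m \<Rightarrow> 'n) \<Rightarrow>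
   ((nat \<Rightarrow> 'm) \<Rightarrow> 'r) set \<Rightarrow> ((nat \<Rightarrow> 'n) \<Rightarrow> 'r) set" where
  "tensor_map R s M N f =
     tensor_lift R s M (tensor_power R s N) (\<lambda>x. pure_tensor R s N (\<lambda>i\<in>{..<s}. f (x i)))"

text \<open>The permutation \<open>\<sigma>\<close> moves the factor in position \<open>i\<close> to position \<open>\<sigma> i\<close>.\<close>

definition tensor_perm ::
  "('r, 'x) ring_scheme \<Rightarrow> nat \<Rightarrow> ('r, 'm) module \<Rightarrow> (nat \<Rightarrow> nat) \<Rightarrow>
   ((nat \<Rightarrow> 'm) \<Rightarrow> 'r) set \<Rightarrow> ((nat \<Rightarrow> 'm) \<Rightarrow> 'r) set" where
  "tensor_perm R s M \<sigma> =
     tensor_lift R s M (tensor_power R s M) (\<lambda>x. pure_tensor R s M (x \<circ> inv_into UNIV \<sigma>))"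

definition schur_hom ::
  "('r, 'x) ring_scheme \<Rightarrow> nat \<Rightarrow> ('r, 'm) module \<Rightarrow> ('r, 'n) module \<Rightarrow>
   (((nat \<Rightarrow> 'm) \<Rightarrow> 'r) set \<Rightarrow> ((nat \<Rightarrow> 'n) \<Rightarrow> 'r) set) set" where
  "schur_hom R s M N =
     {h \<in> lin_hom R (tensor_power R s M) (tensor_power R s N).
        \<forall>\<sigma>. \<sigma> permutes {..<s} \<longrightarrow>
          (\<forall>t\<in>carrier (tensor_power R s M).
             h (tensor_perm R s M \<sigma> t) = tensor_perm R s N \<sigma> (h t))}"

definition schur_hom_module ::
  "('r, 'x) ring_scheme \<Rightarrow> nat \<Rightarrow> ('r, 'm) module \<Rightarrow> ('r, 'n) module \<Rightarrow>
   ('r, ((nat \<Rightarrow> 'm) \<Rightarrow> 'r) set \<Rightarrow> ((nat \<Rightarrow> 'n) \<Rightarrow> 'r) set) module" where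
  "schur_hom_module R s M N =
     (hom_module R (tensor_power R s M) (tensor_power R s N))\<lparr>carrier := schur_hom R s M N\<rparr>"

text \<open>Functors with values in \<open>R\<close>-modules carried by a type \<open>'b\<close>: \<open>farr G M N\<close> is the action on the
  morphisms from \<open>M\<close> to \<open>N\<close>, which are of type \<open>'a\<close>.\<close>

record ('r, 'o, 'a, 'b) module_functor =
  fobj :: "'o \<Rightarrow> ('r, 'b) module"
  farr :: "'o \<Rightarrow> 'o \<Rightarrow> 'a \<Rightarrow> 'b \<Rightarrow> 'b"

type_synonym ('r, 'm, 'b) schur_functor =
  "('r, ('r, 'm) module, ((nat \<Rightarrow> 'm) \<Rightarrow> 'r) set \<Rightarrow> ((nat \<Rightarrow> 'm) \<Rightarrow> 'r) set, 'b) module_functor"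

type_synonym ('r, 'm, 'b) ordinary_functor =
  "('r, ('r, 'm) module, 'm \<Rightarrow> 'm, 'b) module_functor"

locale strict_polynomial_functor =
  fixes R :: "('r, 'x) ring_scheme" and s :: nat and F :: "('r, 'm, 'b) schur_functor"
  assumes fobj_module: "M \<in> fg_projective R \<Longrightarrow> module R (fobj F M)"
    and farr_linear: "\<lbrakk>M \<in> fg_projective R; N \<in> fg_projective R\<rbrakk> \<Longrightarrow>
      linear_map R (schur_hom_module R s M N) (hom_module R (fobj F M) (fobj F N)) (farr F M N)"
    and farr_id: "M \<in> fg_projective R \<Longrightarrow>
      farr F M M (id_map (tensor_power R s M)) = id_map (fobj F M)"
    and farr_comp: "\<lbrakk>M \<in> fg_projective R; N \<in> fg_projective R; P \<in> fg_projective R;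
        g \<in> schur_hom R s M N; h \<in> schur_hom R s N P\<rbrakk> \<Longrightarrow>
      farr F M P (compose (carrier (tensor_power R s M)) h g) =
      compose (carrier (fobj F M)) (farr F N P h) (farr F M N g)"

definition underlying_functor ::
  "('r, 'x) ring_scheme \<Rightarrow> nat \<Rightarrow> ('r, 'm, 'b) schur_functor \<Rightarrow> ('r, 'm, 'b) ordinary_functor" where
  "underlying_functor R s F =
     \<lparr>fobj = fobj F, farr = (\<lambda>M N f. farr F M N (tensor_map R s M N f))\<rparr>"

text \<open>The value of the \<open>d\<close>-th cross effect of \<open>G\<close> at \<open>X\<^sub>1, \<dots>, X\<^sub>d\<close> is realised
  as a submodule of \<open>G ((X\<^sub>1 \<oplus> X\<^sub>2) \<oplus> \<dots> \<oplus> X\<^sub>d)\<close>: each inductive step takes the complement of the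
  two summands that is natural, the common kernel of the maps induced by the two projections from
  \<open>X\<^sub>1 \<oplus> X\<^sub>2\<close>. In the same way \<open>cross_arr\<close> gives the action of the cross effect on
  a list of morphisms \<open>f\<^sub>i\<close> from \<open>X\<^sub>i\<close> to \<open>Y\<^sub>i\<close>; it is the restriction of
  the map below to the cross effect at the \<open>X\<^sub>i\<close>.\<close>

fun dsum_list :: "('r, 'm) module list \<Rightarrow> ('r, 'm) module" where
  "dsum_list [] = zero_module"
| "dsum_list [X] = X"
| "dsum_list (X # Y # Zs) = dsum_list (dsum X Y # Zs)"

fun cross_arr ::
  "('r, 'm, 'b) ordinary_functor \<Rightarrow>
   (('r, 'm) module \<times> ('r, 'm) module \<times> ('m \<Rightarrow> 'm)) list \<Rightarrow> 'b \<Rightarrow> 'b" where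
  "cross_arr G [] = farr G zero_module zero_module (id_map (zero_module :: ('r, 'm) module))"
| "cross_arr G [(X, Y, f)] = farr G X Y f"
| "cross_arr G ((X1, Y1, f1) # (X2, Y2, f2) # fs) =
     cross_arr G ((dsum X1 X2, dsum Y1 Y2, dsum_map X1 X2 f1 f2) # fs)"

text \<open>With the convention that the cross effect in no variables is \<open>G 0\<close>, the
  clause for \<open>d = 0\<close> in \<open>has_degree\<close> below says that \<open>G\<close> is constant and nonzero.\<close>

fun cross_effect :: "('r, 'm, 'b) ordinary_functor \<Rightarrow> ('r, 'm) module list \<Rightarrow> 'b set" where
  "cross_effect G [] = carrier (fobj G zero_module)"
| "cross_effect G [X] =
     {v \<in> carrier (fobj G X). farr G X zero_module (zero_map X) v = \<zero>\<^bsub>fobj G zero_module\<^esub>}"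
| "cross_effect G (X1 # X2 # Xs) =
     {v \<in> cross_effect G (dsum X1 X2 # Xs).
        cross_arr G ((dsum X1 X2, X1, dsum_fst X1 X2) # map (\<lambda>X. (X, X, id_map X)) Xs) v =
          \<zero>\<^bsub>fobj G (dsum_list (X1 # Xs))\<^esub> \<and>
        cross_arr G ((dsum X1 X2, X2, dsum_snd X1 X2) # map (\<lambda>X. (X, X, id_map X)) Xs) v =
          \<zero>\<^bsub>fobj G (dsum_list (X2 # Xs))\<^esub>}"

definition cross_effect_vanishes ::
  "('r, 'x) ring_scheme \<Rightarrow> ('r, 'm, 'b) ordinary_functor \<Rightarrow> nat \<Rightarrow> bool" where
  "cross_effect_vanishes R G d \<longleftrightarrow>
     (\<forall>Xs. length Xs = d \<longrightarrow> set Xs \<subseteq> fg_projective R \<longrightarrow>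
        cross_effect G Xs = {\<zero>\<^bsub>fobj G (dsum_list Xs)\<^esub>})"

definition has_degree ::
  "('r, 'x) ring_scheme \<Rightarrow> ('r, 'm, 'b) ordinary_functor \<Rightarrow> nat \<Rightarrow> bool" where
  "has_degree R G d \<longleftrightarrow> cross_effect_vanishes R G (Suc d) \<and> \<not> cross_effect_vanishes R G d"

text \<open>The value is \<open>-\<infinity>\<close> for the zero functor and \<open>\<infinity>\<close> for a functor that is not polynomial.\<close>

definition functor_degree ::
  "('r, 'x) ring_scheme \<Rightarrow> ('r, 'm, 'b) ordinary_functor \<Rightarrow> nat extended" where
  "functor_degree R G =
     (if \<forall>M\<in>fg_projective R. carrier (fobj G M) = {\<zero>\<^bsub>fobj G M\<^esub>} then Minf
      else if \<exists>d. has_degree R G d then Fin (THE d. has_degree R G d)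
      else Pinf)"

definition strict_degree ::
  "('r, 'x) ring_scheme \<Rightarrow> nat \<Rightarrow> ('r, 'm, 'b) schur_functor \<Rightarrow> nat extended" where
  "strict_degree R s F = functor_degree R (underlying_functor R s F)"

definition torsion_group :: "('a, 'k) monoid_scheme \<Rightarrow> bool" where
  "torsion_group G \<longleftrightarrow> group G \<and> (\<forall>x\<in>carrier G. \<exists>n::nat. 0 < n \<and> x [^]\<^bsub>G\<^esub> n = \<one>\<^bsub>G\<^esub>)"

end

theory Submission
  imports Defs
begin

text \<open>The scalar \<open>k\<close> acts on \<open>M\<^sup>\<otimes>\<^sup>s\<close> as \<open>k\<^sup>s\<close>, so it acts on \<open>F M\<close> as \<open>k\<^sup>s\<close> too. For \<open>v \<in> F M\<close> take the
  alternating sum over the subsets \<open>S\<close> of \<open>{1, \<dots>, s}\<close> of the images of \<open>v\<close> under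
  \<open>F (p\<^sub>S \<circ> \<Delta>)\<close>, where \<open>\<Delta> : M \<rightarrow> M\<^sup>s\<close> is the diagonal and \<open>p\<^sub>S\<close> the projection to the
  summands in \<open>S\<close>. A projection that forgets a summand identifies the terms of this sum in pairs of
  opposite sign, so it lies in the \<open>s\<close>-th cross effect, which vanishes. Applying the fold map
  \<open>M\<^sup>s \<rightarrow> M\<close> turns the sum into \<open>\<Sum>\<^sub>S (-1)\<^bsup>s-|S|\<^esup> |S|\<^sup>s v = s! v\<close>, hence \<open>s! v = 0\<close>.\<close>

section \<open>Linear maps\<close>

text \<open>The obstacle is the shape of the cross effect: an iterated common kernel on a
  left-bracketed direct sum, which opens one summand at a time. The sum over subsets is therefore
  built as an iterated difference, one new coordinate per step, in a recursion where the first
  object \<open>X\<close> and the map \<open>\<phi>\<close> from \<open>M\<close> into it vary. A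
  single such difference need not be killed by every projection; the difference of two of them, for
  two maps into \<open>X\<close>, is, and this is the statement carried through the induction.
  Folding turns the same recursion into that of iterated forward differences of
  \<open>x ^ s\<close>, whose s-th difference is s!. That the scalar passes from the tensor power to
  the value of \<open>F\<close> rests on \<open>F\<close> being linear on Schur morphisms and
  preserving identities. A degree below \<open>s\<close> only says that a cross effect in at most
  \<open>s\<close> variables vanishes; vanishing in exactly \<open>s\<close> variables follows
  because adding a variable shrinks the cross effect.\<close>

lemma linear_mapI:
  assumes "\<And>x. x \<in> carrier M \<Longrightarrow> f x \<in> carrier N"
    and "\<And>x y. \<lbrakk>x \<in> carrier M; y \<in> carrier M\<rbrakk> \<Longrightarrow> f (x \<oplus>\<^bsub>M\<^esub> y) = f x \<oplus>\<^bsub>N\<^esub> f y"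
    and "\<And>r x. \<lbrakk>r \<in> carrier R; x \<in> carrier M\<rbrakk> \<Longrightarrow> f (r \<odot>\<^bsub>M\<^esub> x) = r \<odot>\<^bsub>N\<^esub> f x"
  shows "linear_map R M N f"
  using assms by (auto simp: linear_map_def hom_def)

lemma linear_mapD:
  assumes "linear_map R M N f"
  shows "x \<in> carrier M \<Longrightarrow> f x \<in> carrier N"
    and "\<lbrakk>x \<in> carrier M; y \<in> carrier M\<rbrakk> \<Longrightarrow> f (x \<oplus>\<^bsub>M\<^esub> y) = f x \<oplus>\<^bsub>N\<^esub> f y"
    and "\<lbrakk>r \<in> carrier R; x \<in> carrier M\<rbrakk> \<Longrightarrow> f (r \<odot>\<^bsub>M\<^esub> x) = r \<odot>\<^bsub>N\<^esub> f x"
  using assms by (auto simp: linear_map_def hom_def)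

lemma linear_map_zero:
  assumes "module R M" "module R N" "linear_map R M N f"
  shows "f \<zero>\<^bsub>M\<^esub> = \<zero>\<^bsub>N\<^esub>"
proof -
  interpret M: module R M by fact
  interpret N: module R N by fact
  have "f (\<zero>\<^bsub>R\<^esub> \<odot>\<^bsub>M\<^esub> \<zero>\<^bsub>M\<^esub>) = \<zero>\<^bsub>R\<^esub> \<odot>\<^bsub>N\<^esub> f \<zero>\<^bsub>M\<^esub>"
    by (rule linear_mapD(3)[OF assms(3)]) auto
  then show ?thesis
    using linear_mapD(1)[OF assms(3) M.zero_closed] by simp
qed

lemma linear_map_minus:
  assumes "module R M" "module R N" "linear_map R M N f" "x \<in> carrier M" "y \<in> carrier M"
  shows "f (x \<ominus>\<^bsub>M\<^esub> y) = f x \<ominus>\<^bsub>N\<^esub> f y"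
proof -
  interpret M: module R M by fact
  interpret N: module R N by fact
  have eq: "\<ominus>\<^bsub>M\<^esub> y = (\<ominus>\<^bsub>R\<^esub> \<one>\<^bsub>R\<^esub>) \<odot>\<^bsub>M\<^esub> y"
    using assms by (simp add: M.smult_l_minus)
  have "f (\<ominus>\<^bsub>M\<^esub> y) = \<ominus>\<^bsub>N\<^esub> f y"
    unfolding eq using linear_mapD[OF assms(3)] assms by (simp add: N.smult_l_minus)
  then show ?thesis
    using linear_mapD[OF assms(3)] assms by (simp add: a_minus_def)
qed

lemma lin_homI:
  assumes "f \<in> extensional (carrier M)" "linear_map R M N f"
  shows "f \<in> lin_hom R M N"
  using assms by (simp add: lin_hom_def)

lemma lin_homD:
  assumes "f \<in> lin_hom R M N"
  shows "linear_map R M N f" "f \<in> extensional (carrier M)"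
    and "x \<in> carrier M \<Longrightarrow> f x \<in> carrier N"
    and "\<lbrakk>x \<in> carrier M; y \<in> carrier M\<rbrakk> \<Longrightarrow> f (x \<oplus>\<^bsub>M\<^esub> y) = f x \<oplus>\<^bsub>N\<^esub> f y"
    and "\<lbrakk>r \<in> carrier R; x \<in> carrier M\<rbrakk> \<Longrightarrow> f (r \<odot>\<^bsub>M\<^esub> x) = r \<odot>\<^bsub>N\<^esub> f x"
  using assms linear_mapD[of R M N f] by (auto simp: lin_hom_def)

lemma lin_hom_restrict:
  assumes "module R M"
    and "\<And>x. x \<in> carrier M \<Longrightarrow> f x \<in> carrier N"
    and "\<And>x y. \<lbrakk>x \<in> carrier M; y \<in> carrier M\<rbrakk> \<Longrightarrow> f (x \<oplus>\<^bsub>M\<^esub> y) = f x \<oplus>\<^bsub>N\<^esub> f y"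
    and "\<And>r x. \<lbrakk>r \<in> carrier R; x \<in> carrier M\<rbrakk> \<Longrightarrow> f (r \<odot>\<^bsub>M\<^esub> x) = r \<odot>\<^bsub>N\<^esub> f x"
  shows "(\<lambda>x\<in>carrier M. f x) \<in> lin_hom R M N"
proof -
  interpret module R M by fact
  show ?thesis
    by (intro lin_homI linear_mapI) (use assms(2-) in auto)
qed

lemma zero_lin_hom:
  assumes "module R M" "module R N"
  shows "(\<lambda>x\<in>carrier M. \<zero>\<^bsub>N\<^esub>) \<in> lin_hom R M N"
proof -
  interpret N: module R N by fact
  show ?thesis by (rule lin_hom_restrict[OF assms(1)]) auto
qed

lemma id_map_lin_hom:
  assumes "module R M"
  shows "id_map M \<in> lin_hom R M M"
  unfolding id_map_def by (intro lin_hom_restrict assms) auto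

lemma compose_lin_hom:
  assumes "module R M" "f \<in> lin_hom R M N" "g \<in> lin_hom R N P"
  shows "compose (carrier M) g f \<in> lin_hom R M P"
proof -
  interpret module R M by fact
  show ?thesis
    using assms(2,3) by (auto simp: lin_hom_def linear_map_def hom_def compose_def Pi_def)
qed

lemma lin_hom_eqI:
  assumes "f \<in> lin_hom R M N" "g \<in> lin_hom R M N'" "\<And>x. x \<in> carrier M \<Longrightarrow> f x = g x"
  shows "f = g"
  using assms by (auto simp: lin_hom_def intro: extensionalityI)

text \<open>Equational axioms pass along any surjection that respects the operations. The operations
  of \<open>Q\<close> are given in advance, so well-definedness is not at issue here; for quotients
  that work sits in \<open>coset_smult\<close> and \<open>coset_add\<close>.\<close>

lemma module_surj_image:
  assumes "module R M"
    and onto: "carrier Q = \<pi> ` carrier M"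
    and zero: "\<zero>\<^bsub>Q\<^esub> = \<pi> \<zero>\<^bsub>M\<^esub>"
    and add: "\<And>x y. \<lbrakk>x \<in> carrier M; y \<in> carrier M\<rbrakk> \<Longrightarrow> \<pi> x \<oplus>\<^bsub>Q\<^esub> \<pi> y = \<pi> (x \<oplus>\<^bsub>M\<^esub> y)"
    and smult: "\<And>r x. \<lbrakk>r \<in> carrier R; x \<in> carrier M\<rbrakk> \<Longrightarrow> r \<odot>\<^bsub>Q\<^esub> \<pi> x = \<pi> (r \<odot>\<^bsub>M\<^esub> x)"
  shows "module R Q"
proof -
  interpret M: module R M by fact
  have "abelian_group Q"
  proof (rule abelian_groupI)
    show "\<exists>y\<in>carrier Q. y \<oplus>\<^bsub>Q\<^esub> x = \<zero>\<^bsub>Q\<^esub>" if x: "x \<in> carrier Q" for x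
    proof -
      from x obtain m where m: "m \<in> carrier M" "x = \<pi> m" using onto by auto
      then have "\<pi> (\<ominus>\<^bsub>M\<^esub> m) \<oplus>\<^bsub>Q\<^esub> x = \<zero>\<^bsub>Q\<^esub>" by (simp add: add zero M.l_neg)
      with m onto show ?thesis by blast
    qed
  qed (auto simp: onto zero add M.a_assoc, auto simp: M.a_comm)
  then show ?thesis
    by (intro moduleI M.R.is_cring)
      (auto simp: onto add smult M.smult_l_distr M.smult_r_distr M.smult_assoc1)
qed

section \<open>Free modules and quotients\<close>

lemma free_module_simps [simp]:
  "u \<in> carrier (free_module R I) \<longleftrightarrow> u \<in> I \<rightarrow>\<^sub>E carrier R \<and> finite {i \<in> I. u i \<noteq> \<zero>\<^bsub>R\<^esub>}"
  "\<zero>\<^bsub>free_module R I\<^esub> = (\<lambda>i\<in>I. \<zero>\<^bsub>R\<^esub>)"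
  "u \<oplus>\<^bsub>free_module R I\<^esub> v = (\<lambda>i\<in>I. u i \<oplus>\<^bsub>R\<^esub> v i)"
  "r \<odot>\<^bsub>free_module R I\<^esub> u = (\<lambda>i\<in>I. r \<otimes>\<^bsub>R\<^esub> u i)"
  by (auto simp: free_module_def)

lemma free_module_module:
  fixes R (structure)
  assumes "cring R"
  shows "module R (free_module R I)"
proof -
  interpret cring R by fact
  let ?L = "free_module R I"
  have add: "u \<oplus>\<^bsub>?L\<^esub> v \<in> carrier ?L" if "u \<in> carrier ?L" "v \<in> carrier ?L" for u v
  proof -
    have "{i \<in> I. u i \<oplus> v i \<noteq> \<zero>} \<subseteq> {i \<in> I. u i \<noteq> \<zero>} \<union> {i \<in> I. v i \<noteq> \<zero>}"
      using that by auto
    then have "finite {i \<in> I. u i \<oplus> v i \<noteq> \<zero>}"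
      using that by (auto intro: finite_subset)
    then show ?thesis
      using that by (auto simp: PiE_iff cong: conj_cong)
  qed
  have smult: "r \<odot>\<^bsub>?L\<^esub> u \<in> carrier ?L" if "r \<in> carrier R" "u \<in> carrier ?L" for r u
  proof -
    have "{i \<in> I. r \<otimes> u i \<noteq> \<zero>} \<subseteq> {i \<in> I. u i \<noteq> \<zero>}"
      using that by auto
    then have "finite {i \<in> I. r \<otimes> u i \<noteq> \<zero>}"
      using that by (auto intro: finite_subset)
    then show ?thesis
      using that by (auto simp: PiE_iff cong: conj_cong)
  qed
  have neg: "\<exists>v\<in>carrier ?L. v \<oplus>\<^bsub>?L\<^esub> u = \<zero>\<^bsub>?L\<^esub>" if u: "u \<in> carrier ?L" for u
  proof
    show "(\<ominus> \<one>) \<odot>\<^bsub>?L\<^esub> u \<in> carrier ?L" by (rule smult) (use u in auto)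
    show "(\<ominus> \<one>) \<odot>\<^bsub>?L\<^esub> u \<oplus>\<^bsub>?L\<^esub> u = \<zero>\<^bsub>?L\<^esub>"
      using u by (auto simp: PiE_iff l_minus l_neg intro!: restrict_ext)
  qed
  have zero: "\<zero>\<^bsub>?L\<^esub> \<in> carrier ?L" by auto
  note eqI = extensionalityI[of _ I]
  have "abelian_group ?L"
  proof (rule abelian_groupI)
    fix x y z assume xyz: "x \<in> carrier ?L" "y \<in> carrier ?L" "z \<in> carrier ?L"
    show "(x \<oplus>\<^bsub>?L\<^esub> y) \<oplus>\<^bsub>?L\<^esub> z = x \<oplus>\<^bsub>?L\<^esub> (y \<oplus>\<^bsub>?L\<^esub> z)"
      by (rule eqI) (use xyz in \<open>auto simp: PiE_iff a_assoc\<close>)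
    show "x \<oplus>\<^bsub>?L\<^esub> y = y \<oplus>\<^bsub>?L\<^esub> x"
      by (rule eqI) (use xyz in \<open>auto simp: PiE_iff a_comm\<close>)
    show "\<zero>\<^bsub>?L\<^esub> \<oplus>\<^bsub>?L\<^esub> x = x"
      by (rule eqI) (use xyz in \<open>auto simp: PiE_iff\<close>)
  qed (use add zero neg in blast)+
  then show ?thesis
  proof (intro moduleI is_cring)
    fix a b x y assume ab: "a \<in> carrier R" "b \<in> carrier R" and xy: "x \<in> carrier ?L" "y \<in> carrier ?L"
    show "(a \<oplus> b) \<odot>\<^bsub>?L\<^esub> x = a \<odot>\<^bsub>?L\<^esub> x \<oplus>\<^bsub>?L\<^esub> b \<odot>\<^bsub>?L\<^esub> x"
      by (rule eqI) (use ab xy in \<open>auto simp: PiE_iff l_distr\<close>)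
    show "a \<odot>\<^bsub>?L\<^esub> (x \<oplus>\<^bsub>?L\<^esub> y) = a \<odot>\<^bsub>?L\<^esub> x \<oplus>\<^bsub>?L\<^esub> a \<odot>\<^bsub>?L\<^esub> y"
      by (rule eqI) (use ab xy in \<open>auto simp: PiE_iff r_distr\<close>)
    show "(a \<otimes> b) \<odot>\<^bsub>?L\<^esub> x = a \<odot>\<^bsub>?L\<^esub> (b \<odot>\<^bsub>?L\<^esub> x)"
      by (rule eqI) (use ab xy in \<open>auto simp: PiE_iff m_assoc\<close>)
  next
    fix x assume x: "x \<in> carrier ?L"
    show "\<one> \<odot>\<^bsub>?L\<^esub> x = x"
      by (rule eqI) (use x in \<open>auto simp: PiE_iff\<close>)
  qed (assumption, rule smult)
qed

lemma basis_vec_closed: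
  fixes R (structure)
  assumes "cring R"
  shows "basis_vec R I j \<in> carrier (free_module R I)"
proof -
  interpret cring R by fact
  have "{i \<in> I. basis_vec R I j i \<noteq> \<zero>} \<subseteq> {j}"
    by (auto simp: basis_vec_def split: if_splits)
  then have "finite {i \<in> I. basis_vec R I j i \<noteq> \<zero>}"
    by (rule finite_subset) simp
  then show ?thesis
    by (auto simp: basis_vec_def)
qed

text \<open>The linear extension of \<open>\<phi>\<close> to the free module. The sum runs over the
  support because \<open>I\<close>, later a set of tuples of module elements, may be
  infinite.\<close>

definition free_lift ::
  "('r, 'x) ring_scheme \<Rightarrow> 'i set \<Rightarrow> ('r, 'p) module \<Rightarrow> ('i \<Rightarrow> 'p) \<Rightarrow> ('i \<Rightarrow> 'r) \<Rightarrow> 'p" where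
  "free_lift R I P \<phi> u = (\<Oplus>\<^bsub>P\<^esub>i\<in>{i \<in> I. u i \<noteq> \<zero>\<^bsub>R\<^esub>}. u i \<odot>\<^bsub>P\<^esub> \<phi> i)"

text \<open>Terms outside the support vanish, so any finite superset serves; additivity needs one
  index set common to two vectors.\<close>

lemma free_lift_eq:
  assumes "module R P" "\<phi> \<in> I \<rightarrow> carrier P" "u \<in> I \<rightarrow>\<^sub>E carrier R"
    and "finite A" "A \<subseteq> I" "{i \<in> I. u i \<noteq> \<zero>\<^bsub>R\<^esub>} \<subseteq> A"
  shows "free_lift R I P \<phi> u = (\<Oplus>\<^bsub>P\<^esub>i\<in>A. u i \<odot>\<^bsub>P\<^esub> \<phi> i)"
proof -
  interpret module R P by fact
  show ?thesis
    unfolding free_lift_def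
  proof (rule M.add.finprod_mono_neutral_cong_left)
    show "\<And>i. i \<in> A - {i \<in> I. u i \<noteq> \<zero>\<^bsub>R\<^esub>} \<Longrightarrow> u i \<odot>\<^bsub>P\<^esub> \<phi> i = \<zero>\<^bsub>P\<^esub>"
      using assms(2,5) by (auto intro!: smult_l_null)
    show "(\<lambda>i. u i \<odot>\<^bsub>P\<^esub> \<phi> i) \<in> A \<rightarrow> carrier P"
      using assms by (auto intro!: smult_closed simp: PiE_iff Pi_def)
  qed (use assms in auto)
qed

lemma free_lift_linear:
  assumes "module R P" "\<phi> \<in> I \<rightarrow> carrier P"
  shows "linear_map R (free_module R I) P (free_lift R I P \<phi>)"
proof -
  interpret module R P by fact
  interpret L: module R "free_module R I"
    by (rule free_module_module) (rule R.is_cring)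
  have \<phi>: "\<phi> i \<in> carrier P" if "i \<in> I" for i using assms that by auto
  show ?thesis
  proof (rule linear_mapI)
    fix u assume u: "u \<in> carrier (free_module R I)"
    show "free_lift R I P \<phi> u \<in> carrier P"
      unfolding free_lift_def using u by (intro M.finsum_closed) (auto simp: \<phi> PiE_iff)
    fix v assume v: "v \<in> carrier (free_module R I)"
    have uv: "u i \<in> carrier R" "v i \<in> carrier R" if "i \<in> I" for i
      using u v that by auto
    let ?A = "{i \<in> I. u i \<noteq> \<zero>\<^bsub>R\<^esub>} \<union> {i \<in> I. v i \<noteq> \<zero>\<^bsub>R\<^esub>}"
    have "u \<oplus>\<^bsub>free_module R I\<^esub> v \<in> carrier (free_module R I)"
      using u v by (rule L.a_closed)
    then have "free_lift R I P \<phi> (u \<oplus>\<^bsub>free_module R I\<^esub> v)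
        = (\<Oplus>\<^bsub>P\<^esub>i\<in>?A. (u \<oplus>\<^bsub>free_module R I\<^esub> v) i \<odot>\<^bsub>P\<^esub> \<phi> i)"
      using u v assms by (intro free_lift_eq) (auto simp: PiE_iff)
    also have "\<dots> = (\<Oplus>\<^bsub>P\<^esub>i\<in>?A. u i \<odot>\<^bsub>P\<^esub> \<phi> i \<oplus>\<^bsub>P\<^esub> v i \<odot>\<^bsub>P\<^esub> \<phi> i)"
      by (intro M.finsum_cong') (auto simp: \<phi> uv smult_l_distr)
    also have "\<dots> = (\<Oplus>\<^bsub>P\<^esub>i\<in>?A. u i \<odot>\<^bsub>P\<^esub> \<phi> i) \<oplus>\<^bsub>P\<^esub> (\<Oplus>\<^bsub>P\<^esub>i\<in>?A. v i \<odot>\<^bsub>P\<^esub> \<phi> i)"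
      using u v by (intro M.finsum_addf) (auto simp: \<phi> PiE_iff)
    also have "(\<Oplus>\<^bsub>P\<^esub>i\<in>?A. u i \<odot>\<^bsub>P\<^esub> \<phi> i) = free_lift R I P \<phi> u"
      using u v assms by (intro free_lift_eq[symmetric]) auto
    also have "(\<Oplus>\<^bsub>P\<^esub>i\<in>?A. v i \<odot>\<^bsub>P\<^esub> \<phi> i) = free_lift R I P \<phi> v"
      using u v assms by (intro free_lift_eq[symmetric]) auto
    finally show "free_lift R I P \<phi> (u \<oplus>\<^bsub>free_module R I\<^esub> v) = free_lift R I P \<phi> u \<oplus>\<^bsub>P\<^esub> free_lift R I P \<phi> v" .
  next
    fix r u assume r: "r \<in> carrier R" and u: "u \<in> carrier (free_module R I)"
    let ?A = "{i \<in> I. u i \<noteq> \<zero>\<^bsub>R\<^esub>}"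
    have "r \<odot>\<^bsub>free_module R I\<^esub> u \<in> carrier (free_module R I)"
      using r u by (rule L.smult_closed)
    then have "free_lift R I P \<phi> (r \<odot>\<^bsub>free_module R I\<^esub> u)
        = (\<Oplus>\<^bsub>P\<^esub>i\<in>?A. (r \<odot>\<^bsub>free_module R I\<^esub> u) i \<odot>\<^bsub>P\<^esub> \<phi> i)"
      using r u assms by (intro free_lift_eq) (auto simp: PiE_iff)
    also have "\<dots> = (\<Oplus>\<^bsub>P\<^esub>i\<in>?A. r \<odot>\<^bsub>P\<^esub> (u i \<odot>\<^bsub>P\<^esub> \<phi> i))"
      using r u by (intro M.finsum_cong') (auto simp: \<phi> PiE_iff smult_assoc1)
    also have "\<dots> = r \<odot>\<^bsub>P\<^esub> free_lift R I P \<phi> u"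
      unfolding free_lift_def
      using r u by (intro finsum_smult_ldistr[symmetric]) (auto simp: \<phi> PiE_iff)
    finally show "free_lift R I P \<phi> (r \<odot>\<^bsub>free_module R I\<^esub> u) = r \<odot>\<^bsub>P\<^esub> free_lift R I P \<phi> u" .
  qed
qed

lemma free_lift_basis_vec:
  assumes "module R P" "\<phi> \<in> I \<rightarrow> carrier P" "j \<in> I"
  shows "free_lift R I P \<phi> (basis_vec R I j) = \<phi> j"
proof -
  interpret module R P by fact
  have "free_lift R I P \<phi> (basis_vec R I j) = (\<Oplus>\<^bsub>P\<^esub>i\<in>{j}. basis_vec R I j i \<odot>\<^bsub>P\<^esub> \<phi> i)"
    using assms by (intro free_lift_eq) (auto simp: basis_vec_def split: if_splits)
  also have "\<dots> = \<phi> j"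
    using assms by (auto simp: basis_vec_def Pi_def)
  finally show ?thesis .
qed

text \<open>Induction on the support of \<open>u\<close>: setting one coordinate to zero splits off
  a multiple of a basis vector.\<close>

lemma free_module_linear_eqI:
  assumes "module R P" "linear_map R (free_module R I) P f" "linear_map R (free_module R I) P g"
    and "\<And>i. i \<in> I \<Longrightarrow> f (basis_vec R I i) = g (basis_vec R I i)"
    and "u \<in> carrier (free_module R I)"
  shows "f u = g u"
proof -
  interpret module R P by fact
  let ?L = "free_module R I"
  interpret L: module R ?L
    by (rule free_module_module) (rule R.is_cring)
  have "finite A \<Longrightarrow> u \<in> carrier ?L \<Longrightarrow> {i \<in> I. u i \<noteq> \<zero>\<^bsub>R\<^esub>} = A \<Longrightarrow> f u = g u" for A u
  proof (induction A arbitrary: u rule: finite_induct)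
    case empty
    then have "u = \<zero>\<^bsub>?L\<^esub>"
      by (intro extensionalityI[of _ I]) (auto simp: PiE_iff)
    then show ?case
      using linear_map_zero[OF L.module_axioms assms(1,2)]
        linear_map_zero[OF L.module_axioms assms(1,3)] by metis
  next
    case (insert j A)
    then have j: "j \<in> I" by auto
    let ?e = "basis_vec R I j" and ?w = "u(j := \<zero>\<^bsub>R\<^esub>)"
    have supp: "{i \<in> I. ?w i \<noteq> \<zero>\<^bsub>R\<^esub>} = A" using insert by auto
    have w: "?w \<in> carrier ?L"
      using insert.prems(1) insert.hyps(1) supp j by (auto simp: PiE_iff extensional_def cong: conj_cong)
    have uj: "u j \<in> carrier R" using insert j by (auto simp: PiE_iff)
    have e: "?e \<in> carrier ?L" by (rule basis_vec_closed) (rule R.is_cring)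
    have eq: "u = ?w \<oplus>\<^bsub>?L\<^esub> u j \<odot>\<^bsub>?L\<^esub> ?e"
      using insert.prems(1) uj by (intro extensionalityI[of _ I]) (auto simp: PiE_iff basis_vec_def)
    have "h u = h ?w \<oplus>\<^bsub>P\<^esub> u j \<odot>\<^bsub>P\<^esub> h ?e" if "linear_map R ?L P h" for h
      by (subst eq) (simp only: linear_mapD[OF that] w uj e L.smult_closed)
    moreover have "f ?w = g ?w" by (rule insert.IH[OF w supp])
    ultimately show ?case using assms(2-4) j by metis
  qed
  then show ?thesis using assms(5) by auto
qed

section \<open>Spans and quotient modules\<close>

locale linear_module = module R M
  for R :: "('r, 'x) ring_scheme" (structure) and M :: "('r, 'm) module" (structure)
begin

lemma submodule_span_submodule:
  assumes "S \<subseteq> carrier M"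
  shows "submodule (submodule_span R M S) R M"
proof (rule submoduleI)
  show "submodule_span R M S \<subseteq> carrier M"
    using carrier_is_submodule assms by (auto simp: submodule_span_def)
  show "\<zero>\<^bsub>M\<^esub> \<in> submodule_span R M S"
    by (auto simp: submodule_span_def submodule_def dest: subgroup.one_closed)
next
  fix a b assume "a \<in> submodule_span R M S" "b \<in> submodule_span R M S"
  then show "a \<oplus>\<^bsub>M\<^esub> b \<in> submodule_span R M S"
    unfolding submodule_span_def by (blast intro: submoduleE(5))
next
  fix a assume "a \<in> submodule_span R M S"
  then show "\<ominus>\<^bsub>M\<^esub> a \<in> submodule_span R M S"
    unfolding submodule_span_def by (blast intro: submoduleE(3))
next
  fix r a assume "r \<in> carrier R" "a \<in> submodule_span R M S"
  then show "r \<odot>\<^bsub>M\<^esub> a \<in> submodule_span R M S"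
    unfolding submodule_span_def by (blast intro: submoduleE(4))
qed

lemma submodule_span_superset: "S \<subseteq> submodule_span R M S"
  by (auto simp: submodule_span_def)

lemma submodule_span_least:
  assumes "submodule K R M" "S \<subseteq> K"
  shows "submodule_span R M S \<subseteq> K"
  using assms by (auto simp: submodule_span_def)

end

locale module_quotient = linear_module +
  fixes K assumes sub: "submodule K R M"
begin

sublocale K: abelian_subgroup K M
proof -
  have "subgroup K (add_monoid M)" using sub by (simp add: submodule_def)
  then show "abelian_subgroup K M"
    by (intro abelian_subgroupI3 additive_subgroup.intro M.abelian_group_axioms)
qed

lemma carrier_quotient: "carrier (quotient_module M K) = (\<lambda>x. K +>\<^bsub>M\<^esub> x) ` carrier M"
  by (auto simp: quotient_module_def A_RCOSETS_defs a_r_coset_def)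

text \<open>\<open>quotient_module\<close> takes the union of the cosets of
  \<open>r \<odot> c\<close> over all representatives \<open>c\<close>. These cosets coincide,
  because \<open>K\<close> is stable under \<open>r\<close>, and the union over a nonempty coset is
  then a single coset.\<close>

lemma coset_smult:
  assumes r: "r \<in> carrier R" and x: "x \<in> carrier M"
  shows "r \<odot>\<^bsub>quotient_module M K\<^esub> (K +>\<^bsub>M\<^esub> x) = K +>\<^bsub>M\<^esub> (r \<odot>\<^bsub>M\<^esub> x)"
proof -
  have "K +>\<^bsub>M\<^esub> (r \<odot>\<^bsub>M\<^esub> c) = K +>\<^bsub>M\<^esub> (r \<odot>\<^bsub>M\<^esub> x)" if c: "c \<in> K +>\<^bsub>M\<^esub> x" for c
  proof -
    obtain k where k: "k \<in> K" "c = k \<oplus>\<^bsub>M\<^esub> x" using c by (auto simp: a_r_coset_def')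
    then have "r \<odot>\<^bsub>M\<^esub> c = r \<odot>\<^bsub>M\<^esub> k \<oplus>\<^bsub>M\<^esub> r \<odot>\<^bsub>M\<^esub> x"
      using r x K.a_subset by (auto simp: smult_r_distr)
    moreover have "r \<odot>\<^bsub>M\<^esub> k \<in> K" using submoduleE(4)[OF sub] r k by auto
    ultimately have "r \<odot>\<^bsub>M\<^esub> c \<in> K +>\<^bsub>M\<^esub> (r \<odot>\<^bsub>M\<^esub> x)" by (auto simp: a_r_coset_def')
    then show ?thesis
      using M.a_repr_independence[OF _ _ K.a_subgroup] r x by auto
  qed
  then have "(\<Union>c\<in>K +>\<^bsub>M\<^esub> x. K +>\<^bsub>M\<^esub> (r \<odot>\<^bsub>M\<^esub> c)) = (\<Union>c\<in>K +>\<^bsub>M\<^esub> x. K +>\<^bsub>M\<^esub> (r \<odot>\<^bsub>M\<^esub> x))"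
    by (intro SUP_cong refl)
  moreover have "K +>\<^bsub>M\<^esub> x \<noteq> {}" using K.a_rcos_self x by blast
  ultimately show ?thesis by (simp add: quotient_module_def)
qed

lemma coset_add:
  assumes "x \<in> carrier M" "y \<in> carrier M"
  shows "(K +>\<^bsub>M\<^esub> x) \<oplus>\<^bsub>quotient_module M K\<^esub> (K +>\<^bsub>M\<^esub> y) = K +>\<^bsub>M\<^esub> (x \<oplus>\<^bsub>M\<^esub> y)"
  using assms by (simp add: quotient_module_def K.a_rcos_sum)

lemma quotient_module_module: "module R (quotient_module M K)"
  by (rule module_surj_image[of R M _ "\<lambda>x. K +>\<^bsub>M\<^esub> x"])
    (use K.a_subset in \<open>auto simp: module_axioms carrier_quotient coset_smult coset_add,
      auto simp: quotient_module_def\<close>)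

lemma coset_linear: "linear_map R M (quotient_module M K) (\<lambda>x. K +>\<^bsub>M\<^esub> x)"
  by (rule linear_mapI) (auto simp: carrier_quotient coset_smult coset_add)

text \<open>The map evaluates \<open>f\<close> at a chosen representative of each coset; another
  choice differs by an element of \<open>K\<close>, which \<open>f\<close> kills.\<close>

lemma quotient_lift:
  assumes "module R P" and f: "linear_map R M P f" and K: "\<And>x. x \<in> K \<Longrightarrow> f x = \<zero>\<^bsub>P\<^esub>"
  obtains h where "h \<in> lin_hom R (quotient_module M K) P"
    "\<And>x. x \<in> carrier M \<Longrightarrow> h (K +>\<^bsub>M\<^esub> x) = f x"
proof -
  interpret P: module R P by fact
  interpret Q: module R "quotient_module M K" by (rule quotient_module_module)
  note f = linear_mapD[OF f]
  define h where "h = (\<lambda>C\<in>carrier (quotient_module M K). f (SOME c. c \<in> C))"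
  have h: "h (K +>\<^bsub>M\<^esub> x) = f x" if x: "x \<in> carrier M" for x
  proof -
    have "(SOME c. c \<in> K +>\<^bsub>M\<^esub> x) \<in> K +>\<^bsub>M\<^esub> x"
      using K.a_rcos_self[OF x] by (rule someI)
    then obtain k where "k \<in> K" "(SOME c. c \<in> K +>\<^bsub>M\<^esub> x) = k \<oplus>\<^bsub>M\<^esub> x"
      by (auto simp: a_r_coset_def')
    then show ?thesis
      using x K K.a_subset by (auto simp: h_def carrier_quotient f)
  qed
  have "h \<in> lin_hom R (quotient_module M K) P"
  proof (rule lin_homI[OF _ linear_mapI])
    show "h \<in> extensional (carrier (quotient_module M K))" by (simp add: h_def)
  qed (auto simp: carrier_quotient coset_smult coset_add h f)
  with h show thesis using that by blast
qed

end

section \<open>Tensor powers\<close>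

text \<open>The two laws are what the relations in \<open>tensor_relations\<close> become under a
  map given on basis vectors. Both are phrased with updated tuples \<open>x(i := a)\<close>, so that
  the comparison is direct.\<close>

definition multilinear ::
  "('r, 'x) ring_scheme \<Rightarrow> nat \<Rightarrow> ('r, 'm) module \<Rightarrow> ('r, 'p) module \<Rightarrow> ((nat \<Rightarrow> 'm) \<Rightarrow> 'p) \<Rightarrow> bool"
  where
  "multilinear R s M P \<phi> \<longleftrightarrow>
     \<phi> \<in> tuples s M \<rightarrow> carrier P \<and>
     (\<forall>x\<in>tuples s M. \<forall>i<s. \<forall>a\<in>carrier M. \<forall>b\<in>carrier M.
        \<phi> (x(i := a \<oplus>\<^bsub>M\<^esub> b)) = \<phi> (x(i := a)) \<oplus>\<^bsub>P\<^esub> \<phi> (x(i := b))) \<and>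
     (\<forall>x\<in>tuples s M. \<forall>i<s. \<forall>r\<in>carrier R. \<forall>a\<in>carrier M.
        \<phi> (x(i := r \<odot>\<^bsub>M\<^esub> a)) = r \<odot>\<^bsub>P\<^esub> \<phi> (x(i := a)))"

lemma multilinearD:
  assumes "multilinear R s M P \<phi>"
  shows "x \<in> tuples s M \<Longrightarrow> \<phi> x \<in> carrier P"
    and "\<lbrakk>x \<in> tuples s M; i < s; a \<in> carrier M; b \<in> carrier M\<rbrakk> \<Longrightarrow>
      \<phi> (x(i := a \<oplus>\<^bsub>M\<^esub> b)) = \<phi> (x(i := a)) \<oplus>\<^bsub>P\<^esub> \<phi> (x(i := b))"
    and "\<lbrakk>x \<in> tuples s M; i < s; r \<in> carrier R; a \<in> carrier M\<rbrakk> \<Longrightarrow>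
      \<phi> (x(i := r \<odot>\<^bsub>M\<^esub> a)) = r \<odot>\<^bsub>P\<^esub> \<phi> (x(i := a))"
  using assms by (auto simp: multilinear_def)

lemma tuples_upd:
  assumes "x \<in> tuples s M" "i < s" "a \<in> carrier M"
  shows "x(i := a) \<in> tuples s M"
  using assms by (auto simp: tuples_def PiE_iff extensional_def)

text \<open>A permutation of \<open>{..<s}\<close> fixes all other numbers, so the reindexed tuple
  stays extensional.\<close>

lemma tuples_compose_permutes:
  assumes "x \<in> tuples s M" "\<sigma> permutes {..<s}"
  shows "x \<circ> inv_into UNIV \<sigma> \<in> tuples s M"
proof -
  have "inv_into UNIV \<sigma> permutes {..<s}" using assms(2) by (rule permutes_inv)
  then have "inv_into UNIV \<sigma> i < s \<longleftrightarrow> i < s" for i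
    using permutes_in_image by fastforce
  then show ?thesis using assms(1) by (auto simp: tuples_def PiE_iff extensional_def)
qed

lemma tuples_map:
  assumes "x \<in> tuples s M" "f \<in> lin_hom R M N"
  shows "(\<lambda>i\<in>{..<s}. f (x i)) \<in> tuples s N"
  using assms lin_homD(3)[OF assms(2)] by (auto simp: tuples_def)

context linear_module
begin

lemma tuple_module_module: "module R (free_module R (tuples s M))"
  by (rule free_module_module) (rule R.is_cring)

lemma tensor_relations_subset: "tensor_relations R s M \<subseteq> carrier (free_module R (tuples s M))"
proof -
  let ?L = "free_module R (tuples s M)"
  interpret L: linear_module R ?L by (rule linear_module.intro) (rule tuple_module_module)
  \<comment> \<open>The pointwise formulas have to stay folded: only the module laws of the free
    module are used.\<close>
  note [simp del] = free_module_simps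
  have e: "basis_vec R (tuples s M) x \<in> carrier ?L" for x
    by (rule basis_vec_closed) (rule R.is_cring)
  show ?thesis
    unfolding tensor_relations_def Let_def by (auto intro!: L.minus_closed e L.a_closed L.smult_closed)
qed

lemma tensor_quotient: "module_quotient R (free_module R (tuples s M)) (tensor_kernel R s M)"
proof -
  interpret L: linear_module R "free_module R (tuples s M)"
    by (rule linear_module.intro) (rule tuple_module_module)
  show ?thesis
    unfolding module_quotient_def module_quotient_axioms_def linear_module_def tensor_kernel_def
    by (intro conjI L.module_axioms L.submodule_span_submodule tensor_relations_subset)
qed

lemma tensor_power_module: "module R (tensor_power R s M)"
  unfolding tensor_power_def by (rule module_quotient.quotient_module_module[OF tensor_quotient])

text \<open>Maps out of the quotient are determined by their pullbacks to the free module, and the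
  classes of its basis vectors are the pure tensors.\<close>

lemma tensor_lin_hom_eqI:
  assumes "module R P" "f \<in> lin_hom R (tensor_power R s M) P" "g \<in> lin_hom R (tensor_power R s M) P"
    and eq: "\<And>x. x \<in> tuples s M \<Longrightarrow> f (pure_tensor R s M x) = g (pure_tensor R s M x)"
  shows "f = g"
proof (rule lin_hom_eqI[OF assms(2,3)])
  let ?L = "free_module R (tuples s M)"
  interpret Q: module_quotient R ?L "tensor_kernel R s M" by (rule tensor_quotient)
  fix t assume "t \<in> carrier (tensor_power R s M)"
  then obtain u where u: "u \<in> carrier ?L" "t = tensor_kernel R s M +>\<^bsub>?L\<^esub> u"
    unfolding tensor_power_def Q.carrier_quotient by blast
  have lin: "linear_map R ?L P (\<lambda>u. h (tensor_kernel R s M +>\<^bsub>?L\<^esub> u))"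
    if h: "h \<in> lin_hom R (tensor_power R s M) P" for h
    using linear_mapD[OF Q.coset_linear] lin_homD[OF h[unfolded tensor_power_def]]
    by (intro linear_mapI) (auto simp del: free_module_simps)
  show "f t = g t"
    unfolding u(2)
    by (rule free_module_linear_eqI[OF assms(1) lin[OF assms(2)] lin[OF assms(3)] _ u(1)])
      (use eq in \<open>simp add: pure_tensor_def\<close>)
qed

text \<open>In each law the two sides are classes of elements that differ by one defining
  relation.\<close>

lemma pure_tensor_multilinear:
  "multilinear R s M (tensor_power R s M) (pure_tensor R s M)"
proof -
  let ?L = "free_module R (tuples s M)" and ?K = "tensor_kernel R s M" and ?e = "basis_vec R (tuples s M)"
  interpret L: linear_module R ?L by (rule linear_module.intro) (rule tuple_module_module)
  interpret Q: module_quotient R ?L ?K by (rule tensor_quotient)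
  note [simp del] = free_module_simps
  have e: "?e x \<in> carrier ?L" for x
    by (rule basis_vec_closed) (rule R.is_cring)
  have K: "tensor_relations R s M \<subseteq> ?K"
    unfolding tensor_kernel_def by (rule L.submodule_span_superset)
  have coset_eq: "?K +>\<^bsub>?L\<^esub> u = ?K +>\<^bsub>?L\<^esub> v" if "u \<ominus>\<^bsub>?L\<^esub> v \<in> ?K" "u \<in> carrier ?L" "v \<in> carrier ?L" for u v
    using that Q.K.a_rcos_module[OF that(3,2)] Q.K.a_repr_independence'[OF _ that(3)]
    by (simp add: a_minus_def)
  note cl = linear_mapD[OF Q.coset_linear]
  show ?thesis
    unfolding multilinear_def tensor_power_def pure_tensor_def
  proof (intro conjI ballI allI impI)
    show "(\<lambda>x. ?K +>\<^bsub>?L\<^esub> ?e x) \<in> tuples s M \<rightarrow> carrier (quotient_module ?L ?K)"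
      using cl(1)[OF e] by auto
    fix x i assume x: "x \<in> tuples s M" "i < s"
    { fix a b assume ab: "a \<in> carrier M" "b \<in> carrier M"
      have "?e (x(i := a \<oplus>\<^bsub>M\<^esub> b)) \<ominus>\<^bsub>?L\<^esub> (?e (x(i := a)) \<oplus>\<^bsub>?L\<^esub> ?e (x(i := b))) \<in> tensor_relations R s M"
        unfolding tensor_relations_def Let_def using x ab by blast
      then show "?K +>\<^bsub>?L\<^esub> ?e (x(i := a \<oplus>\<^bsub>M\<^esub> b)) = (?K +>\<^bsub>?L\<^esub> ?e (x(i := a))) \<oplus>\<^bsub>quotient_module ?L ?K\<^esub> (?K +>\<^bsub>?L\<^esub> ?e (x(i := b)))"
        using K by (simp add: Q.coset_add e coset_eq subset_iff) }
    { fix r a assume ra: "r \<in> carrier R" "a \<in> carrier M"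
      have "?e (x(i := r \<odot>\<^bsub>M\<^esub> a)) \<ominus>\<^bsub>?L\<^esub> r \<odot>\<^bsub>?L\<^esub> ?e (x(i := a)) \<in> tensor_relations R s M"
        unfolding tensor_relations_def Let_def using x ra by blast
      then show "?K +>\<^bsub>?L\<^esub> ?e (x(i := r \<odot>\<^bsub>M\<^esub> a)) = r \<odot>\<^bsub>quotient_module ?L ?K\<^esub> (?K +>\<^bsub>?L\<^esub> ?e (x(i := a)))"
        using K ra by (simp add: Q.coset_smult e coset_eq subset_iff) }
  qed
qed

text \<open>Existence: the linear extension to the free module kills the relations, hence their
  span, and descends. Uniqueness on pure tensors makes the description in \<open>tensor_lift\<close>
  denote this map.\<close>

lemma tensor_lift:
  assumes "module R P" and \<phi>: "multilinear R s M P \<phi>"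
  shows "tensor_lift R s M P \<phi> \<in> lin_hom R (tensor_power R s M) P"
    and "x \<in> tuples s M \<Longrightarrow> tensor_lift R s M P \<phi> (pure_tensor R s M x) = \<phi> x"
proof -
  let ?L = "free_module R (tuples s M)" and ?K = "tensor_kernel R s M" and ?e = "basis_vec R (tuples s M)"
  interpret P: module R P by fact
  interpret L: linear_module R ?L by (rule linear_module.intro) (rule tuple_module_module)
  interpret Q: module_quotient R ?L ?K by (rule tensor_quotient)
  note [simp del] = free_module_simps
  have e: "?e x \<in> carrier ?L" for x
    by (rule basis_vec_closed) (rule R.is_cring)
  let ?f = "free_lift R (tuples s M) P \<phi>"
  note \<phi> = multilinearD[OF \<phi>]
  have \<phi>_Pi: "\<phi> \<in> tuples s M \<rightarrow> carrier P" using \<phi> by auto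
  note lin = free_lift_linear[OF assms(1) \<phi>_Pi]
  note fb = free_lift_basis_vec[OF assms(1) \<phi>_Pi]
  \<comment> \<open>The span is the least submodule containing the relations, so it suffices that
    the kernel is a submodule.\<close>
  have sub: "submodule {u \<in> carrier ?L. ?f u = \<zero>\<^bsub>P\<^esub>} R ?L"
  proof (rule L.submoduleI)
    fix a assume "a \<in> {u \<in> carrier ?L. ?f u = \<zero>\<^bsub>P\<^esub>}"
    then show "\<ominus>\<^bsub>?L\<^esub> a \<in> {u \<in> carrier ?L. ?f u = \<zero>\<^bsub>P\<^esub>}"
      using linear_map_minus[OF L.module_axioms P.module_axioms lin L.zero_closed, of a]
        linear_map_zero[OF L.module_axioms P.module_axioms lin] by (auto simp: a_minus_def)
  qed (auto simp: linear_mapD[OF lin] linear_map_zero[OF L.module_axioms P.module_axioms lin])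
  have "tensor_relations R s M \<subseteq> {u \<in> carrier ?L. ?f u = \<zero>\<^bsub>P\<^esub>}"
  proof -
    have "?f u = \<zero>\<^bsub>P\<^esub>" if "u \<in> tensor_relations R s M" for u
      using that unfolding tensor_relations_def Let_def
      by (auto simp: linear_map_minus[OF L.module_axioms P.module_axioms lin] linear_mapD[OF lin] e
          fb tuples_upd \<phi> P.M.minus_eq P.M.r_neg)
    then show ?thesis using tensor_relations_subset by blast
  qed
  then have ker: "?K \<subseteq> {u \<in> carrier ?L. ?f u = \<zero>\<^bsub>P\<^esub>}"
    unfolding tensor_kernel_def using sub by (rule L.submodule_span_least[rotated])
  then obtain h where h: "h \<in> lin_hom R (tensor_power R s M) P"
    "\<And>u. u \<in> carrier ?L \<Longrightarrow> h (?K +>\<^bsub>?L\<^esub> u) = ?f u"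
    using Q.quotient_lift[OF assms(1) lin] unfolding tensor_power_def by blast
  then have hp: "h (pure_tensor R s M x) = \<phi> x" if "x \<in> tuples s M" for x
    using that by (simp add: pure_tensor_def e fb)
  have "tensor_lift R s M P \<phi> = h"
    unfolding tensor_lift_def
    using h(1) hp tensor_lin_hom_eqI[OF assms(1)] by (intro the_equality) auto
  then show "tensor_lift R s M P \<phi> \<in> lin_hom R (tensor_power R s M) P"
    "x \<in> tuples s M \<Longrightarrow> tensor_lift R s M P \<phi> (pure_tensor R s M x) = \<phi> x"
    using h(1) hp by auto
qed

lemma pure_tensor_closed: "x \<in> tuples s M \<Longrightarrow> pure_tensor R s M x \<in> carrier (tensor_power R s M)"
  by (rule multilinearD(1)[OF pure_tensor_multilinear])

section \<open>Permutations, induced maps and scalars on tensor powers\<close>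

lemma tensor_perm:
  assumes \<sigma>: "\<sigma> permutes {..<s}"
  shows "tensor_perm R s M \<sigma> \<in> lin_hom R (tensor_power R s M) (tensor_power R s M)"
    and "x \<in> tuples s M \<Longrightarrow>
      tensor_perm R s M \<sigma> (pure_tensor R s M x) = pure_tensor R s M (x \<circ> inv_into UNIV \<sigma>)"
proof -
  \<comment> \<open>Changing entry \<open>i\<close> before the permutation changes entry
    \<open>\<sigma> i\<close> after it, so the laws for pure tensors are applied at position
    \<open>\<sigma> i\<close>.\<close>
  have upd: "x(i := a) \<circ> inv_into UNIV \<sigma> = (x \<circ> inv_into UNIV \<sigma>)(\<sigma> i := a)" for x :: "nat \<Rightarrow> 'm" and i a
    using permutes_inverses[OF \<sigma>] by (auto simp: fun_eq_iff)
  have \<sigma>s: "\<sigma> i < s" if "i < s" for i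
    using permutes_in_image[OF \<sigma>] that by auto
  have "multilinear R s M (tensor_power R s M) (\<lambda>x. pure_tensor R s M (x \<circ> inv_into UNIV \<sigma>))"
    unfolding multilinear_def
    by (auto simp: upd \<sigma>s \<sigma> tuples_compose_permutes multilinearD[OF pure_tensor_multilinear])
  note lift = tensor_lift[OF tensor_power_module this]
  show "tensor_perm R s M \<sigma> \<in> lin_hom R (tensor_power R s M) (tensor_power R s M)"
    "x \<in> tuples s M \<Longrightarrow>
      tensor_perm R s M \<sigma> (pure_tensor R s M x) = pure_tensor R s M (x \<circ> inv_into UNIV \<sigma>)"
    using lift unfolding tensor_perm_def by auto
qed

lemma tensor_map:
  assumes N: "module R N" and f: "f \<in> lin_hom R M N"
  shows "tensor_map R s M N f \<in> lin_hom R (tensor_power R s M) (tensor_power R s N)"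
    and "x \<in> tuples s M \<Longrightarrow>
      tensor_map R s M N f (pure_tensor R s M x) = pure_tensor R s N (\<lambda>i\<in>{..<s}. f (x i))"
proof -
  interpret N: linear_module R N by (rule linear_module.intro) fact
  have upd: "(\<lambda>j\<in>{..<s}. f ((x(i := a)) j)) = (\<lambda>j\<in>{..<s}. f (x j))(i := f a)" if "i < s" for x i a
    using that by (auto simp: fun_eq_iff)
  have "multilinear R s M (tensor_power R s N) (\<lambda>x. pure_tensor R s N (\<lambda>i\<in>{..<s}. f (x i)))"
    unfolding multilinear_def
    by (auto simp: upd tuples_map[OF _ f] lin_homD(3-5)[OF f] multilinearD[OF N.pure_tensor_multilinear]
        simp del: fun_upd_apply)
  note lift = tensor_lift[OF N.tensor_power_module this]
  show "tensor_map R s M N f \<in> lin_hom R (tensor_power R s M) (tensor_power R s N)"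
    "x \<in> tuples s M \<Longrightarrow>
      tensor_map R s M N f (pure_tensor R s M x) = pure_tensor R s N (\<lambda>i\<in>{..<s}. f (x i))"
    using lift unfolding tensor_map_def by auto
qed

text \<open>Applying \<open>f\<close> to every entry commutes with moving the entries. To see this
  on pure tensors only, both composites are compared as elements of one Hom set.\<close>

lemma tensor_map_schur_hom:
  assumes N: "module R N" and f: "f \<in> lin_hom R M N"
  shows "tensor_map R s M N f \<in> schur_hom R s M N"
proof -
  interpret N: linear_module R N by (rule linear_module.intro) fact
  have "tensor_map R s M N f (tensor_perm R s M \<sigma> t) = tensor_perm R s N \<sigma> (tensor_map R s M N f t)"
    if \<sigma>: "\<sigma> permutes {..<s}" and t: "t \<in> carrier (tensor_power R s M)" for \<sigma> t
  proof -
    have "compose (carrier (tensor_power R s M)) (tensor_map R s M N f) (tensor_perm R s M \<sigma>) =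
      compose (carrier (tensor_power R s M)) (tensor_perm R s N \<sigma>) (tensor_map R s M N f)"
    proof (rule tensor_lin_hom_eqI[OF N.tensor_power_module])
      fix x assume x: "x \<in> tuples s M"
      have "\<sigma> permutes {..<s} \<Longrightarrow> (\<lambda>i\<in>{..<s}. f ((x \<circ> inv_into UNIV \<sigma>) i)) = (\<lambda>i\<in>{..<s}. f (x i)) \<circ> inv_into UNIV \<sigma>"
        using permutes_in_image[OF permutes_inv[OF \<sigma>]] by (auto simp: fun_eq_iff)
      then show "compose (carrier (tensor_power R s M)) (tensor_map R s M N f) (tensor_perm R s M \<sigma>) (pure_tensor R s M x) =
          compose (carrier (tensor_power R s M)) (tensor_perm R s N \<sigma>) (tensor_map R s M N f) (pure_tensor R s M x)"
        using x \<sigma> by (simp add: compose_eq pure_tensor_closed tensor_map[OF N f] tensor_perm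
            N.tensor_perm tuples_map[OF _ f] tuples_compose_permutes)
    qed (use tensor_map[OF N f] tensor_perm[OF \<sigma>] N.tensor_perm[OF \<sigma>]
        in \<open>auto intro!: compose_lin_hom tensor_power_module\<close>)
    from fun_cong[OF this, of t] t show ?thesis by (simp add: compose_eq)
  qed
  then show ?thesis
    using tensor_map(1)[OF N f] by (simp add: schur_hom_def)
qed

lemma tensor_map_id: "tensor_map R s M M (id_map M) = id_map (tensor_power R s M)"
proof (rule tensor_lin_hom_eqI[OF tensor_power_module])
  fix x assume x: "x \<in> tuples s M"
  then have "(\<lambda>i\<in>{..<s}. id_map M (x i)) = x"
    by (auto simp: tuples_def id_map_def PiE_iff intro: extensionalityI[of _ "{..<s}"])
  then show "tensor_map R s M M (id_map M) (pure_tensor R s M x) = id_map (tensor_power R s M) (pure_tensor R s M x)"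
    using x by (simp add: tensor_map[OF module_axioms id_map_lin_hom[OF module_axioms]])
      (simp add: id_map_def pure_tensor_closed)
qed (auto intro!: tensor_map id_map_lin_hom tensor_power_module module_axioms)

lemma tensor_map_compose:
  assumes N: "module R N" and P: "module R P"
    and f: "f \<in> lin_hom R M N" and g: "g \<in> lin_hom R N P"
  shows "tensor_map R s M P (compose (carrier M) g f) =
    compose (carrier (tensor_power R s M)) (tensor_map R s N P g) (tensor_map R s M N f)"
proof -
  interpret N: linear_module R N by (rule linear_module.intro) fact
  interpret P: linear_module R P by (rule linear_module.intro) fact
  note gf = compose_lin_hom[OF module_axioms f g]
  show ?thesis
  proof (rule tensor_lin_hom_eqI[OF P.tensor_power_module])
    fix x assume x: "x \<in> tuples s M"
    then have "(\<lambda>i\<in>{..<s}. compose (carrier M) g f (x i)) = (\<lambda>i\<in>{..<s}. g ((\<lambda>i\<in>{..<s}. f (x i)) i))"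
      by (auto simp: tuples_def PiE_iff compose_eq)
    then show "tensor_map R s M P (compose (carrier M) g f) (pure_tensor R s M x) =
      compose (carrier (tensor_power R s M)) (tensor_map R s N P g) (tensor_map R s M N f) (pure_tensor R s M x)"
      using x by (simp add: compose_eq pure_tensor_closed tensor_map[OF P gf] tensor_map[OF N f]
          N.tensor_map[OF P g] tuples_map[OF _ f] cong: restrict_cong)
  qed (use tensor_map[OF N f] tensor_map[OF P gf] N.tensor_map[OF P g]
      in \<open>auto intro!: compose_lin_hom tensor_power_module\<close>)
qed

lemma smult_lin_hom:
  assumes "r \<in> carrier R"
  shows "(\<lambda>x\<in>carrier M. r \<odot>\<^bsub>M\<^esub> x) \<in> lin_hom R M M"
proof (rule lin_hom_restrict[OF module_axioms])
  fix r' x assume "r' \<in> carrier R" "x \<in> carrier M"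
  then show "r \<odot>\<^bsub>M\<^esub> (r' \<odot>\<^bsub>M\<^esub> x) = r' \<odot>\<^bsub>M\<^esub> (r \<odot>\<^bsub>M\<^esub> x)"
    using assms by (simp flip: smult_assoc1 add: R.m_comm)
qed (use assms in \<open>auto simp: smult_r_distr\<close>)

text \<open>The scalar is pulled out of one entry at a time: \<open>y k\<close> has its first
  \<open>k\<close> entries multiplied and accounts for the \<open>k\<close>-th power of
  \<open>r\<close>.\<close>

lemma pure_tensor_smult:
  assumes r: "r \<in> carrier R" and x: "x \<in> tuples s M"
  shows "pure_tensor R s M (\<lambda>i\<in>{..<s}. r \<odot>\<^bsub>M\<^esub> x i) = (r [^]\<^bsub>R\<^esub> s) \<odot>\<^bsub>tensor_power R s M\<^esub> pure_tensor R s M x"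
proof -
  interpret T: module R "tensor_power R s M" by (rule tensor_power_module)
  define y where "y k = (\<lambda>i\<in>{..<s}. if i < k then r \<odot>\<^bsub>M\<^esub> x i else x i)" for k
  have xc: "x i \<in> carrier M" if "i < s" for i
    using x that by (auto simp: tuples_def)
  have y: "y k \<in> tuples s M" for k
    using r by (auto simp: y_def tuples_def xc)
  have "pure_tensor R s M (y k) = (r [^]\<^bsub>R\<^esub> k) \<odot>\<^bsub>tensor_power R s M\<^esub> pure_tensor R s M x" if "k \<le> s" for k
    using that
  proof (induction k)
    case 0
    have "y 0 = x" using x by (auto simp: y_def tuples_def PiE_iff intro: extensionalityI[of _ "{..<s}"])
    then show ?case using x by (simp add: pure_tensor_closed)
  next
    case (Suc k)
    \<comment> \<open>Reading \<open>y k\<close> as its own update at \<open>k\<close> brings both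
      tuples into the form of the scalar law.\<close>
    have "y (Suc k) = (y k)(k := r \<odot>\<^bsub>M\<^esub> x k)" "(y k)(k := x k) = y k"
      using Suc.prems by (auto simp: y_def fun_eq_iff)
    then have "pure_tensor R s M (y (Suc k)) = r \<odot>\<^bsub>tensor_power R s M\<^esub> pure_tensor R s M (y k)"
      using multilinearD(3)[OF pure_tensor_multilinear y, of k r "x k" k] Suc.prems r xc[of k] by simp
    then show ?case
      using Suc r x by (simp add: T.smult_assoc1[symmetric] pure_tensor_closed R.m_comm)
  qed
  from this[of s] show ?thesis by (simp add: y_def cong: restrict_cong)
qed

text \<open>This is where the weight enters: each of the \<open>s\<close> factors contributes one
  \<open>r\<close>.\<close>

lemma tensor_map_smult:
  assumes r: "r \<in> carrier R"
  shows "tensor_map R s M M (\<lambda>x\<in>carrier M. r \<odot>\<^bsub>M\<^esub> x) =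
    (\<lambda>t\<in>carrier (tensor_power R s M). (r [^]\<^bsub>R\<^esub> s) \<odot>\<^bsub>tensor_power R s M\<^esub> t)"
proof (rule tensor_lin_hom_eqI[OF tensor_power_module])
  interpret T: linear_module R "tensor_power R s M"
    by (rule linear_module.intro) (rule tensor_power_module)
  show "(\<lambda>t\<in>carrier (tensor_power R s M). (r [^]\<^bsub>R\<^esub> s) \<odot>\<^bsub>tensor_power R s M\<^esub> t)
      \<in> lin_hom R (tensor_power R s M) (tensor_power R s M)"
    using r by (intro T.smult_lin_hom) simp
  fix x assume x: "x \<in> tuples s M"
  then have "(\<lambda>i\<in>{..<s}. (\<lambda>x\<in>carrier M. r \<odot>\<^bsub>M\<^esub> x) (x i)) = (\<lambda>i\<in>{..<s}. r \<odot>\<^bsub>M\<^esub> x i)"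
    by (auto simp: tuples_def fun_eq_iff)
  then show "tensor_map R s M M (\<lambda>x\<in>carrier M. r \<odot>\<^bsub>M\<^esub> x) (pure_tensor R s M x) =
    (\<lambda>t\<in>carrier (tensor_power R s M). (r [^]\<^bsub>R\<^esub> s) \<odot>\<^bsub>tensor_power R s M\<^esub> t) (pure_tensor R s M x)"
    using x by (simp add: tensor_map[OF module_axioms smult_lin_hom[OF r]] pure_tensor_smult r pure_tensor_closed)
qed (use r in \<open>auto intro!: tensor_map smult_lin_hom module_axioms\<close>)

end

section \<open>Finitely generated projective modules\<close>

lemma inj_pair_code:
  assumes "inj (c :: 'm \<times> 'm \<Rightarrow> 'm)"
  shows "inj (pair_code :: 'm \<times> 'm \<Rightarrow> 'm)"
  unfolding pair_code_def using assms by (rule someI[of inj])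

text \<open>The free module on the empty set is zero. The lemma also settles a universe with a
  single element, which has no room for a disjoint union of two index sets.\<close>

lemma trivial_projective:
  fixes M :: "('r, 'm) module"
  assumes "module R M" "carrier M = {\<zero>\<^bsub>M\<^esub>}"
  shows "projective R M"
proof -
  interpret M: linear_module R M by (rule linear_module.intro) fact
  let ?L = "free_module R ({} :: 'm set)"
  interpret L: module R ?L by (rule free_module_module) (rule M.R.is_cring)
  have "(\<lambda>x\<in>carrier M. \<zero>\<^bsub>?L\<^esub>) \<in> lin_hom R M ?L"
    by (rule lin_hom_restrict[OF assms(1)]) (auto simp del: free_module_simps)
  moreover have "(\<lambda>x\<in>carrier ?L. \<zero>\<^bsub>M\<^esub>) \<in> lin_hom R ?L M"
    by (rule lin_hom_restrict[OF L.module_axioms]) (auto simp del: free_module_simps)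
  moreover have "compose (carrier M) (\<lambda>x\<in>carrier ?L. \<zero>\<^bsub>M\<^esub>) (\<lambda>x\<in>carrier M. \<zero>\<^bsub>?L\<^esub>) = id_map M"
    unfolding compose_def id_map_def
    by (rule restrict_ext) (use assms(2) in \<open>auto simp del: free_module_simps\<close>)
  ultimately show ?thesis unfolding projective_def by blast
qed

lemma zero_module_module:
  assumes "cring R"
  shows "module R zero_module"
  by (intro moduleI abelian_groupI assms) (auto simp: zero_module_def)

lemma zero_module_fg_projective:
  assumes "cring R"
  shows "(zero_module :: ('r, 'm) module) \<in> fg_projective R"
proof -
  let ?Z = "zero_module :: ('r, 'm) module"
  interpret Z: linear_module R ?Z
    by (rule linear_module.intro) (rule zero_module_module[OF assms])
  have eq: "carrier ?Z = {\<zero>\<^bsub>?Z\<^esub>}" by (simp add: zero_module_def)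
  have "submodule_span R ?Z {} = carrier ?Z"
    using Z.submoduleE(1,2)[OF Z.submodule_span_submodule[of "{}"]] unfolding eq by auto
  then have "finitely_generated R ?Z"
    unfolding finitely_generated_def by (intro exI[of _ "{}"]) simp
  then show ?thesis
    using trivial_projective[OF Z.module_axioms eq] Z.module_axioms by (simp add: fg_projective_def)
qed

text \<open>\<open>c\<close> witnesses that injective pairings exist; from this the fixed choice
  \<open>pair_code\<close> inherits injectivity.\<close>

locale paired_universe =
  fixes R :: "('r, 'x) ring_scheme" and c :: "'m \<times> 'm \<Rightarrow> 'm"
  assumes cring_R: "cring R" and inj_c: "inj c"
begin

sublocale R: cring R by (rule cring_R)

lemma code_simps [simp]:
  "code_fst (pair_code (a :: 'm, b)) = a" "code_snd (pair_code (a :: 'm, b)) = b"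
  "pair_code (a :: 'm, b) = pair_code (a', b') \<longleftrightarrow> a = a' \<and> b = b'"
  using inj_pair_code[OF inj_c] by (auto simp: code_fst_def code_snd_def inj_eq)

lemma dsum_simps [simp]:
  fixes M N :: "('r, 'm) module"
  shows "pair_code (a, b) \<in> carrier (dsum M N) \<longleftrightarrow> a \<in> carrier M \<and> b \<in> carrier N"
    "\<zero>\<^bsub>dsum M N\<^esub> = pair_code (\<zero>\<^bsub>M\<^esub>, \<zero>\<^bsub>N\<^esub>)"
    "pair_code (a, b) \<oplus>\<^bsub>dsum M N\<^esub> pair_code (a', b') = pair_code (a \<oplus>\<^bsub>M\<^esub> a', b \<oplus>\<^bsub>N\<^esub> b')"
    "r \<odot>\<^bsub>dsum M N\<^esub> pair_code (a, b) = pair_code (r \<odot>\<^bsub>M\<^esub> a, r \<odot>\<^bsub>N\<^esub> b)"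
  by (auto simp: dsum_def)

lemma dsum_cases:
  fixes M N :: "('r, 'm) module"
  assumes "z \<in> carrier (dsum M N)"
  obtains a b where "z = pair_code (a, b)" "a \<in> carrier M" "b \<in> carrier N"
  using assms by (auto simp: dsum_def)

lemma dsum_module:
  fixes M N :: "('r, 'm) module"
  assumes "module R M" "module R N"
  shows "module R (dsum M N)"
proof -
  interpret M: module R M by fact
  interpret N: module R N by fact
  have "\<exists>w\<in>carrier (dsum M N). w \<oplus>\<^bsub>dsum M N\<^esub> z = \<zero>\<^bsub>dsum M N\<^esub>" if "z \<in> carrier (dsum M N)" for z
    using that
  proof (rule dsum_cases)
    fix a b assume "z = pair_code (a, b)" "a \<in> carrier M" "b \<in> carrier N"
    then show ?thesis
      by (intro bexI[of _ "pair_code (\<ominus>\<^bsub>M\<^esub> a, \<ominus>\<^bsub>N\<^esub> b)"]) (simp_all add: M.l_neg N.l_neg)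
  qed
  then show ?thesis
    by (intro moduleI abelian_groupI cring_R)
      (auto elim!: dsum_cases simp: M.a_assoc N.a_assoc M.smult_l_distr M.smult_r_distr M.smult_assoc1
        N.smult_l_distr N.smult_r_distr N.smult_assoc1 intro: M.a_comm N.a_comm)
qed

lemma dsum_fst_lin_hom:
  fixes M N :: "('r, 'm) module"
  assumes "module R M" "module R N"
  shows "dsum_fst M N \<in> lin_hom R (dsum M N) M"
  unfolding dsum_fst_def
  by (rule lin_hom_restrict[OF dsum_module[OF assms]]) (auto elim!: dsum_cases)

lemma dsum_snd_lin_hom:
  fixes M N :: "('r, 'm) module"
  assumes "module R M" "module R N"
  shows "dsum_snd M N \<in> lin_hom R (dsum M N) N"
  unfolding dsum_snd_def
  by (rule lin_hom_restrict[OF dsum_module[OF assms]]) (auto elim!: dsum_cases)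

lemma dsum_map_lin_hom:
  fixes M N M' N' :: "('r, 'm) module"
  assumes "module R M" "module R N" "f \<in> lin_hom R M M'" "g \<in> lin_hom R N N'"
  shows "dsum_map M N f g \<in> lin_hom R (dsum M N) (dsum M' N')"
  unfolding dsum_map_def
  by (rule lin_hom_restrict[OF dsum_module[OF assms(1,2)]])
    (auto elim!: dsum_cases simp: lin_homD(3-5)[OF assms(3)] lin_homD(3-5)[OF assms(4)])

definition dsum_pair :: "('r, 'a) module \<Rightarrow> ('a \<Rightarrow> 'm) \<Rightarrow> ('a \<Rightarrow> 'm) \<Rightarrow> 'a \<Rightarrow> 'm" where
  "dsum_pair A f g = (\<lambda>x\<in>carrier A. pair_code (f x, g x))"

definition dsum_copair ::
  "('r, 'm) module \<Rightarrow> ('r, 'm) module \<Rightarrow> ('r, 'p) module \<Rightarrow> ('m \<Rightarrow> 'p) \<Rightarrow> ('m \<Rightarrow> 'p) \<Rightarrow> 'm \<Rightarrow> 'p" where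
  "dsum_copair M N P f g = (\<lambda>z\<in>carrier (dsum M N). f (code_fst z) \<oplus>\<^bsub>P\<^esub> g (code_snd z))"

lemma dsum_pair_lin_hom:
  fixes M N :: "('r, 'm) module"
  assumes "module R A" "f \<in> lin_hom R A M" "g \<in> lin_hom R A N"
  shows "dsum_pair A f g \<in> lin_hom R A (dsum M N)"
  unfolding dsum_pair_def
  by (rule lin_hom_restrict[OF assms(1)])
    (auto simp: lin_homD(3-5)[OF assms(2)] lin_homD(3-5)[OF assms(3)])

lemma dsum_copair_lin_hom:
  fixes M N :: "('r, 'm) module"
  assumes "module R M" "module R N" "module R P" "f \<in> lin_hom R M P" "g \<in> lin_hom R N P"
  shows "dsum_copair M N P f g \<in> lin_hom R (dsum M N) P"
proof -
  interpret P: module R P by fact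
  show ?thesis
    unfolding dsum_copair_def
    by (rule lin_hom_restrict[OF dsum_module[OF assms(1,2)]])
      (auto elim!: dsum_cases simp: lin_homD(3-5)[OF assms(4)] lin_homD(3-5)[OF assms(5)]
        P.smult_r_distr P.a_ac)
qed

text \<open>The images of the generators under the two inclusions generate. In each summand the
  elements whose image lies in their span \<open>?K\<close> form a submodule containing a generating
  set, and every pair is a sum of two such images.\<close>

lemma dsum_finitely_generated:
  fixes M N :: "('r, 'm) module"
  assumes M: "module R M" "finitely_generated R M" and N: "module R N" "finitely_generated R N"
  shows "finitely_generated R (dsum M N)"
proof -
  interpret M: linear_module R M by (rule linear_module.intro) fact
  interpret N: linear_module R N by (rule linear_module.intro) fact
  interpret S: linear_module R "dsum M N" by (rule linear_module.intro) (rule dsum_module[OF M(1) N(1)])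
  obtain A where A: "finite A" "A \<subseteq> carrier M" "submodule_span R M A = carrier M"
    using M(2) by (auto simp: finitely_generated_def)
  obtain B where B: "finite B" "B \<subseteq> carrier N" "submodule_span R N B = carrier N"
    using N(2) by (auto simp: finitely_generated_def)
  let ?C = "(\<lambda>a. pair_code (a, \<zero>\<^bsub>N\<^esub>)) ` A \<union> (\<lambda>b. pair_code (\<zero>\<^bsub>M\<^esub>, b)) ` B"
  have C: "?C \<subseteq> carrier (dsum M N)" using A B by auto
  let ?K = "submodule_span R (dsum M N) ?C"
  have K: "submodule ?K R (dsum M N)" by (rule S.submodule_span_submodule[OF C])
  note KE = S.submoduleE[OF K]
  have CK: "?C \<subseteq> ?K" by (rule S.submodule_span_superset)
  have zero: "\<zero>\<^bsub>dsum M N\<^esub> \<in> ?K"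
    using K by (auto simp: submodule_def dest: subgroup.one_closed)
  have "submodule {a \<in> carrier M. pair_code (a, \<zero>\<^bsub>N\<^esub>) \<in> ?K} R M"
  proof (rule M.submoduleI)
    fix a assume a: "a \<in> {a \<in> carrier M. pair_code (a, \<zero>\<^bsub>N\<^esub>) \<in> ?K}"
    then show "\<ominus>\<^bsub>M\<^esub> a \<in> {a \<in> carrier M. pair_code (a, \<zero>\<^bsub>N\<^esub>) \<in> ?K}"
      using KE(4)[of "\<ominus>\<^bsub>R\<^esub> \<one>\<^bsub>R\<^esub>" "pair_code (a, \<zero>\<^bsub>N\<^esub>)"] by (simp add: M.smult_l_minus)
    fix b assume b: "b \<in> {a \<in> carrier M. pair_code (a, \<zero>\<^bsub>N\<^esub>) \<in> ?K}"
    show "a \<oplus>\<^bsub>M\<^esub> b \<in> {a \<in> carrier M. pair_code (a, \<zero>\<^bsub>N\<^esub>) \<in> ?K}"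
      using KE(5)[of "pair_code (a, \<zero>\<^bsub>N\<^esub>)" "pair_code (b, \<zero>\<^bsub>N\<^esub>)"] a b by simp
  next
    fix r a assume "r \<in> carrier R" "a \<in> {a \<in> carrier M. pair_code (a, \<zero>\<^bsub>N\<^esub>) \<in> ?K}"
    then show "r \<odot>\<^bsub>M\<^esub> a \<in> {a \<in> carrier M. pair_code (a, \<zero>\<^bsub>N\<^esub>) \<in> ?K}"
      using KE(4)[of r "pair_code (a, \<zero>\<^bsub>N\<^esub>)"] by simp
  qed (use zero in auto)
  moreover have "A \<subseteq> {a \<in> carrier M. pair_code (a, \<zero>\<^bsub>N\<^esub>) \<in> ?K}" using A CK by auto
  ultimately have MK: "carrier M \<subseteq> {a \<in> carrier M. pair_code (a, \<zero>\<^bsub>N\<^esub>) \<in> ?K}"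
    by (rule M.submodule_span_least[of _ A, unfolded A(3)])
  have "submodule {b \<in> carrier N. pair_code (\<zero>\<^bsub>M\<^esub>, b) \<in> ?K} R N"
  proof (rule N.submoduleI)
    fix a assume a: "a \<in> {b \<in> carrier N. pair_code (\<zero>\<^bsub>M\<^esub>, b) \<in> ?K}"
    then show "\<ominus>\<^bsub>N\<^esub> a \<in> {b \<in> carrier N. pair_code (\<zero>\<^bsub>M\<^esub>, b) \<in> ?K}"
      using KE(4)[of "\<ominus>\<^bsub>R\<^esub> \<one>\<^bsub>R\<^esub>" "pair_code (\<zero>\<^bsub>M\<^esub>, a)"] by (simp add: N.smult_l_minus)
    fix b assume b: "b \<in> {b \<in> carrier N. pair_code (\<zero>\<^bsub>M\<^esub>, b) \<in> ?K}"
    show "a \<oplus>\<^bsub>N\<^esub> b \<in> {b \<in> carrier N. pair_code (\<zero>\<^bsub>M\<^esub>, b) \<in> ?K}"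
      using KE(5)[of "pair_code (\<zero>\<^bsub>M\<^esub>, a)" "pair_code (\<zero>\<^bsub>M\<^esub>, b)"] a b by simp
  next
    fix r a assume "r \<in> carrier R" "a \<in> {b \<in> carrier N. pair_code (\<zero>\<^bsub>M\<^esub>, b) \<in> ?K}"
    then show "r \<odot>\<^bsub>N\<^esub> a \<in> {b \<in> carrier N. pair_code (\<zero>\<^bsub>M\<^esub>, b) \<in> ?K}"
      using KE(4)[of r "pair_code (\<zero>\<^bsub>M\<^esub>, a)"] by simp
  qed (use zero in auto)
  moreover have "B \<subseteq> {b \<in> carrier N. pair_code (\<zero>\<^bsub>M\<^esub>, b) \<in> ?K}" using B CK by auto
  ultimately have NK: "carrier N \<subseteq> {b \<in> carrier N. pair_code (\<zero>\<^bsub>M\<^esub>, b) \<in> ?K}"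
    by (rule N.submodule_span_least[of _ B, unfolded B(3)])
  have "z \<in> ?K" if "z \<in> carrier (dsum M N)" for z
    using that
  proof (rule dsum_cases)
    fix a b assume z: "z = pair_code (a, b)" "a \<in> carrier M" "b \<in> carrier N"
    then have "pair_code (a, \<zero>\<^bsub>N\<^esub>) \<oplus>\<^bsub>dsum M N\<^esub> pair_code (\<zero>\<^bsub>M\<^esub>, b) \<in> ?K"
      using MK NK by (intro KE(5)) auto
    then show "z \<in> ?K" using z by simp
  qed
  then have "?K = carrier (dsum M N)" using KE(1) by blast
  then show ?thesis
    unfolding finitely_generated_def using C A B by (intro exI[of _ ?C]) auto
qed

lemma dsum_projective:
  fixes M N :: "('r, 'm) module"
  assumes M: "module R M" "projective R M" and N: "module R N" "projective R N"
  shows "projective R (dsum M N)"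
proof (cases "\<exists>x y :: 'm. x \<noteq> y") \<comment> \<open>two elements tag two disjoint copies of the index sets\<close>
  case False
  then have "carrier (dsum M N) = {\<zero>\<^bsub>dsum M N\<^esub>}"
    using abelian_monoid.zero_closed[of "dsum M N"] dsum_module[OF M(1) N(1)]
    by (auto simp: module_def abelian_group_def simp del: dsum_simps)
  then show ?thesis by (rule trivial_projective[OF dsum_module[OF M(1) N(1)]])
next
  case True
  then obtain x y :: 'm where xy: "x \<noteq> y" by blast
  interpret M: linear_module R M by (rule linear_module.intro) fact
  interpret N: linear_module R N by (rule linear_module.intro) fact
  obtain I i p where I: "i \<in> lin_hom R M (free_module R (I :: 'm set))" "p \<in> lin_hom R (free_module R I) M"
    "compose (carrier M) p i = id_map M"
    using M(2) by (auto simp: projective_def)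
  obtain J j q where J: "j \<in> lin_hom R N (free_module R (J :: 'm set))" "q \<in> lin_hom R (free_module R J) N"
    "compose (carrier N) q j = id_map N"
    using N(2) by (auto simp: projective_def)
  define K where "K = (\<lambda>k. pair_code (x, k)) ` I \<union> (\<lambda>k. pair_code (y, k)) ` J"
  let ?L = "free_module R K"
  interpret L: module R ?L by (rule free_module_module) (rule cring_R)
  have pi: "p (i a) = a" if "a \<in> carrier M" for a
    using fun_cong[OF I(3), of a] that by (simp add: compose_eq id_map_def)
  have qj: "q (j a) = a" if "a \<in> carrier N" for a
    using fun_cong[OF J(3), of a] that by (simp add: compose_eq id_map_def)
  \<comment> \<open>These maps pass between functions on the tagged union \<open>K\<close> and pairs
    of functions on \<open>I\<close> and \<open>J\<close>. For a retraction it suffices that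
    \<open>split\<close> undoes \<open>join\<close>.\<close>
  define split where "split u = (\<lambda>k\<in>I. u (pair_code (x, k)), \<lambda>k\<in>J. u (pair_code (y, k)))"
    for u :: "'m \<Rightarrow> 'r"
  define join where "join u v = (\<lambda>k\<in>K. if code_fst k = x then u (code_snd k) else v (code_snd k))"
    for u v :: "'m \<Rightarrow> 'r"
  have join: "join u v \<in> carrier ?L" "split (join u v) = (u, v)"
    if u: "u \<in> carrier (free_module R I)" and v: "v \<in> carrier (free_module R J)" for u v
  proof -
    have "{k \<in> K. join u v k \<noteq> \<zero>\<^bsub>R\<^esub>} \<subseteq> (\<lambda>k. pair_code (x, k)) ` {k \<in> I. u k \<noteq> \<zero>\<^bsub>R\<^esub>}
        \<union> (\<lambda>k. pair_code (y, k)) ` {k \<in> J. v k \<noteq> \<zero>\<^bsub>R\<^esub>}"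
      using xy by (auto simp: join_def K_def split: if_splits)
    then have "finite {k \<in> K. join u v k \<noteq> \<zero>\<^bsub>R\<^esub>}"
      by (rule finite_subset) (use u v in auto)
    then show "join u v \<in> carrier ?L"
      using u v xy by (auto simp: join_def K_def PiE_iff)
    show "split (join u v) = (u, v)"
      unfolding split_def prod.inject
      by (intro conjI extensionalityI[of _ I] extensionalityI[of _ J])
        (use u v xy in \<open>auto simp: join_def K_def PiE_iff\<close>)
  qed
  have split: "fst (split u) \<in> carrier (free_module R I)" "snd (split u) \<in> carrier (free_module R J)"
    if u: "u \<in> carrier ?L" for u
  proof -
    have "finite {k \<in> K. u k \<noteq> \<zero>\<^bsub>R\<^esub>}" using u by auto
    \<comment> \<open>Tagging is injective, so a finite support has finite preimages under
      it.\<close>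
    then have "finite ((\<lambda>k. pair_code (x, k)) -` {k \<in> K. u k \<noteq> \<zero>\<^bsub>R\<^esub>})"
      "finite ((\<lambda>k. pair_code (y, k)) -` {k \<in> K. u k \<noteq> \<zero>\<^bsub>R\<^esub>})"
      by (rule finite_vimageI, simp add: inj_def)+
    then have "finite {k \<in> I. u (pair_code (x, k)) \<noteq> \<zero>\<^bsub>R\<^esub>}"
      "finite {k \<in> J. u (pair_code (y, k)) \<noteq> \<zero>\<^bsub>R\<^esub>}"
      by - (erule finite_subset[rotated], force simp: K_def)+
    then show "fst (split u) \<in> carrier (free_module R I)" "snd (split u) \<in> carrier (free_module R J)"
      using u by (auto simp: split_def K_def PiE_iff cong: conj_cong)
  qed
  let ?i = "\<lambda>z\<in>carrier (dsum M N). join (i (code_fst z)) (j (code_snd z))"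
  let ?p = "\<lambda>u\<in>carrier ?L. pair_code (p (fst (split u)), q (snd (split u)))"
  note [simp del] = free_module_simps(1)
  have join_add: "join (u \<oplus>\<^bsub>free_module R I\<^esub> u') (v \<oplus>\<^bsub>free_module R J\<^esub> v') = join u v \<oplus>\<^bsub>?L\<^esub> join u' v'"
    for u u' v v'
    unfolding join_def free_module_simps by (rule restrict_ext) (use xy in \<open>auto simp: K_def\<close>)
  have join_smult: "join (r \<odot>\<^bsub>free_module R I\<^esub> u) (r \<odot>\<^bsub>free_module R J\<^esub> v) = r \<odot>\<^bsub>?L\<^esub> join u v"
    for r u v
    unfolding join_def free_module_simps by (rule restrict_ext) (use xy in \<open>auto simp: K_def\<close>)
  have split_add: "fst (split (u \<oplus>\<^bsub>?L\<^esub> v)) = fst (split u) \<oplus>\<^bsub>free_module R I\<^esub> fst (split v)"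
    "snd (split (u \<oplus>\<^bsub>?L\<^esub> v)) = snd (split u) \<oplus>\<^bsub>free_module R J\<^esub> snd (split v)" for u v
    by (auto simp: split_def K_def fun_eq_iff)
  have split_smult: "fst (split (r \<odot>\<^bsub>?L\<^esub> u)) = r \<odot>\<^bsub>free_module R I\<^esub> fst (split u)"
    "snd (split (r \<odot>\<^bsub>?L\<^esub> u)) = r \<odot>\<^bsub>free_module R J\<^esub> snd (split u)" for r u
    by (auto simp: split_def K_def fun_eq_iff)
  note [simp del] = free_module_simps
  have "?i \<in> lin_hom R (dsum M N) ?L"
    by (rule lin_hom_restrict[OF dsum_module[OF M(1) N(1)]])
      (auto elim!: dsum_cases simp: join lin_homD(3-5)[OF I(1)] lin_homD(3-5)[OF J(1)] join_add join_smult)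
  moreover have "?p \<in> lin_hom R ?L (dsum M N)"
    by (rule lin_hom_restrict[OF L.module_axioms])
      (auto simp: split lin_homD(3-5)[OF I(2)] lin_homD(3-5)[OF J(2)] split_add split_smult)
  moreover have "compose (carrier (dsum M N)) ?p ?i = id_map (dsum M N)"
    unfolding compose_def id_map_def
    by (rule restrict_ext)
      (auto elim!: dsum_cases simp: join lin_homD(3)[OF I(1)] lin_homD(3)[OF J(1)] pi qj)
  ultimately show ?thesis unfolding projective_def by blast
qed

lemma dsum_fg_projective:
  fixes M N :: "('r, 'm) module"
  assumes "M \<in> fg_projective R" "N \<in> fg_projective R"
  shows "dsum M N \<in> fg_projective R"
  using assms by (auto simp: fg_projective_def intro: dsum_module dsum_finitely_generated dsum_projective)

end

section \<open>Finite differences\<close>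

text \<open>Iterated forward difference with step 1. The recursion mirrors the way
  \<open>cross_diff\<close> adds a coordinate: after folding, an identity raises the argument by one
  and a zero leaves it.\<close>

primrec fdiff :: "nat \<Rightarrow> (int \<Rightarrow> int) \<Rightarrow> int \<Rightarrow> int" where
  "fdiff 0 f k = f k"
| "fdiff (Suc n) f k = fdiff n f (k + 1) - fdiff n f k"

text \<open>Differencing commutes with shifting, so the extra difference may be taken first, where
  it lowers the degree of a power.\<close>

lemma fdiff_Suc': "fdiff (Suc n) f k = fdiff n (\<lambda>x. f (x + 1) - f x) k"
proof (induction n arbitrary: k)
  case (Suc n)
  show ?case
    by (simp only: fdiff.simps(2)[of "Suc n"] fdiff.simps(2)[of n "\<lambda>x. f (x + 1) - f x"] Suc.IH)
qed simp

lemma fdiff_sum: "fdiff n (\<lambda>x. \<Sum>j\<in>A. c j * g j x) k = (\<Sum>j\<in>A. c j * fdiff n (g j) k)"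
  by (induction n arbitrary: k) (auto simp: sum_subtractf right_diff_distrib)

text \<open>One difference lowers the degree by one. The claim covers all exponents up to
  \<open>n\<close> because the lower powers in the binomial expansion have to vanish under the
  remaining differences.\<close>

lemma fdiff_power: "p \<le> n \<Longrightarrow> fdiff n (\<lambda>x. x ^ p) k = (if p = n then fact n else 0)"
proof (induction n arbitrary: p)
  case 0
  then show ?case by simp
next
  case (Suc n)
  have "(\<lambda>x::int. (x + 1) ^ p - x ^ p) = (\<lambda>x. \<Sum>j<p. int (p choose j) * x ^ j)"
    by (simp add: fun_eq_iff binomial_ring flip: lessThan_Suc_atMost)
  then have "fdiff (Suc n) (\<lambda>x. x ^ p) k = (\<Sum>j<p. int (p choose j) * fdiff n (\<lambda>x. x ^ j) k)"
    by (simp only: fdiff_Suc' fdiff_sum)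
  \<comment> \<open>The index \<open>j = n\<close> lies below \<open>p\<close> only when
    \<open>p = Suc n\<close>, and then it contributes \<open>Suc n\<close> times
    \<open>fact n\<close>.\<close>
  also have "\<dots> = (\<Sum>j<p. if j = n then int (p choose n) * fact n else 0)"
    using Suc by (intro sum.cong) auto
  finally show ?case using Suc.prems by auto
qed

section \<open>Cross effects\<close>

lemma (in cring) add_pow_one_mult: "[(a * b)] \<cdot> \<one> = ([a] \<cdot> \<one>) \<otimes> ([b] \<cdot> \<one>)" for a b :: int
  by (simp add: add_pow_rdistr_int add.int_pow_pow mult.commute)

lemma (in cring) add_pow_one_power: "[(a ^ n)] \<cdot> \<one> = ([a] \<cdot> \<one>) [^] n" for a :: int and n :: nat
  by (induction n) (simp_all add: add_pow_one_mult m_comm)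

text \<open>Links the two readings of an integer multiple: homogeneity speaks of the action of
  \<open>R\<close>, torsion of repeated addition.\<close>

lemma (in module) add_pow_one_smult:
  assumes "x \<in> carrier M"
  shows "([(int n)] \<cdot>\<^bsub>R\<^esub> \<one>\<^bsub>R\<^esub>) \<odot>\<^bsub>M\<^esub> x = [n] \<cdot>\<^bsub>M\<^esub> x"
  using assms
  by (induction n) (auto simp: smult_l_distr add_pow_int_ge[of "1 + int _"] add_pow_int_ge nat_add_distrib)

text \<open>The interface on which the argument with cross effects runs, free of tensor powers.
  Composition is stated on elements, the form in which images of \<open>v\<close> are
  followed.\<close>

locale projective_functor = paired_universe R c
  for R :: "('r, 'x) ring_scheme" and c :: "'m \<times> 'm \<Rightarrow> 'm" +
  fixes G :: "('r, 'm, 'b) ordinary_functor"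
  assumes fobj_module: "M \<in> fg_projective R \<Longrightarrow> module R (fobj G M)"
    and farr_lin_hom: "\<lbrakk>M \<in> fg_projective R; N \<in> fg_projective R; f \<in> lin_hom R M N\<rbrakk> \<Longrightarrow>
      farr G M N f \<in> lin_hom R (fobj G M) (fobj G N)"
    and farr_compose: "\<lbrakk>M \<in> fg_projective R; N \<in> fg_projective R; P \<in> fg_projective R;
        f \<in> lin_hom R M N; g \<in> lin_hom R N P; v \<in> carrier (fobj G M)\<rbrakk> \<Longrightarrow>
      farr G M P (compose (carrier M) g f) v = farr G N P g (farr G M N f v)"
begin

lemma fg_module: "M \<in> fg_projective R \<Longrightarrow> module R M"
  by (simp add: fg_projective_def)

lemma zero_fg: "(zero_module :: ('r, 'm) module) \<in> fg_projective R"
  by (rule zero_module_fg_projective[OF cring_R])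

lemma zero_map_lin_hom:
  fixes X :: "('r, 'm) module"
  assumes "module R X"
  shows "zero_map X \<in> lin_hom R X zero_module"
  unfolding zero_map_def by (rule lin_hom_restrict[OF assms]) (auto simp: zero_module_def)

lemma dsum_list_fg:
  fixes Xs :: "('r, 'm) module list"
  assumes "set Xs \<subseteq> fg_projective R"
  shows "dsum_list Xs \<in> fg_projective R"
  using assms by (induction Xs rule: dsum_list.induct) (auto simp: zero_fg dsum_fg_projective)

text \<open>\<open>X\<close>, \<open>Y\<close> and \<open>h\<close> vary in the induction because
  every further identity is absorbed into the first entry through \<open>dsum_map\<close>.\<close>

lemma cross_arr_lin_hom:
  assumes "X \<in> fg_projective R" "Y \<in> fg_projective R" "h \<in> lin_hom R X Y" "set Zs \<subseteq> fg_projective R"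
  shows "cross_arr G ((X, Y, h) # map (\<lambda>Z. (Z, Z, id_map Z)) Zs) \<in>
    lin_hom R (fobj G (dsum_list (X # Zs))) (fobj G (dsum_list (Y # Zs)))"
  using assms
proof (induction Zs arbitrary: X Y h)
  case Nil
  then show ?case by (simp add: farr_lin_hom)
next
  case (Cons Z Zs)
  then show ?case
    using Cons.IH[of "dsum X Z" "dsum Y Z" "dsum_map X Z h (id_map Z)"]
    by (simp add: dsum_fg_projective dsum_map_lin_hom fg_module id_map_lin_hom)
qed

section \<open>Closure properties of cross effects, and the degree\<close>

lemma cross_effect_subset:
  assumes "Xs \<noteq> []"
  shows "cross_effect G Xs \<subseteq> carrier (fobj G (dsum_list Xs))"
  using assms by (induction Xs rule: dsum_list.induct) auto

lemma cross_effect_zero: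
  assumes "Xs \<noteq> []" "set Xs \<subseteq> fg_projective R"
  shows "\<zero>\<^bsub>fobj G (dsum_list Xs)\<^esub> \<in> cross_effect G Xs"
  using assms
proof (induction Xs rule: dsum_list.induct)
  case (2 X)
  interpret X: module R "fobj G X" using 2 fobj_module by simp
  show ?case
    using 2 linear_map_zero[OF _ _ lin_homD(1)[OF farr_lin_hom[OF _ zero_fg zero_map_lin_hom]]]
    by (auto simp: fobj_module zero_fg fg_module)
next
  case (3 X Y Zs)
  have fg: "X \<in> fg_projective R" "Y \<in> fg_projective R" "set Zs \<subseteq> fg_projective R"
    and XY: "dsum X Y \<in> fg_projective R"
    using 3 by (auto simp: dsum_fg_projective)
  note mods = fobj_module[OF dsum_list_fg]
  have "cross_arr G ((dsum X Y, X, dsum_fst X Y) # map (\<lambda>Z. (Z, Z, id_map Z)) Zs)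
      \<zero>\<^bsub>fobj G (dsum_list (dsum X Y # Zs))\<^esub> = \<zero>\<^bsub>fobj G (dsum_list (X # Zs))\<^esub>"
    by (rule linear_map_zero[OF mods mods lin_homD(1)[OF cross_arr_lin_hom]])
      (use fg XY in \<open>auto intro!: dsum_fst_lin_hom fg_module\<close>)
  moreover have "cross_arr G ((dsum X Y, Y, dsum_snd X Y) # map (\<lambda>Z. (Z, Z, id_map Z)) Zs)
      \<zero>\<^bsub>fobj G (dsum_list (dsum X Y # Zs))\<^esub> = \<zero>\<^bsub>fobj G (dsum_list (Y # Zs))\<^esub>"
    by (rule linear_map_zero[OF mods mods lin_homD(1)[OF cross_arr_lin_hom]])
      (use fg XY in \<open>auto intro!: dsum_snd_lin_hom fg_module\<close>)
  ultimately show ?case using 3 XY by simp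
qed simp

lemma cross_effect_minus:
  assumes "Xs \<noteq> []" "set Xs \<subseteq> fg_projective R" "v \<in> cross_effect G Xs" "w \<in> cross_effect G Xs"
  shows "v \<ominus>\<^bsub>fobj G (dsum_list Xs)\<^esub> w \<in> cross_effect G Xs"
  using assms
proof (induction Xs rule: dsum_list.induct)
  case (2 X)
  interpret X: module R "fobj G X" using 2 fobj_module by simp
  interpret Z: module R "fobj G zero_module" by (rule fobj_module[OF zero_fg])
  show ?case
    using 2 linear_map_minus[OF _ _ lin_homD(1)[OF farr_lin_hom[OF _ zero_fg zero_map_lin_hom]], of X v w]
    by (simp add: fobj_module zero_fg fg_module Z.M.minus_eq)
next
  case (3 X Y Zs)
  have fg: "X \<in> fg_projective R" "Y \<in> fg_projective R" "set Zs \<subseteq> fg_projective R"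
    and XY: "dsum X Y \<in> fg_projective R"
    using 3 by (auto simp: dsum_fg_projective)
  note mods = fobj_module[OF dsum_list_fg]
  interpret X: module R "fobj G (dsum_list (X # Zs))" by (rule mods) (use fg in auto)
  interpret Y: module R "fobj G (dsum_list (Y # Zs))" by (rule mods) (use fg in auto)
  have vw: "v \<in> cross_effect G (dsum X Y # Zs)" "w \<in> cross_effect G (dsum X Y # Zs)"
    using 3 by auto
  then have vwc: "v \<in> carrier (fobj G (dsum_list (dsum X Y # Zs)))" "w \<in> carrier (fobj G (dsum_list (dsum X Y # Zs)))"
    using cross_effect_subset by blast+
  have "cross_arr G ((dsum X Y, X, dsum_fst X Y) # map (\<lambda>Z. (Z, Z, id_map Z)) Zs)
      (v \<ominus>\<^bsub>fobj G (dsum_list (dsum X Y # Zs))\<^esub> w) = \<zero>\<^bsub>fobj G (dsum_list (X # Zs))\<^esub>"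
    by (subst linear_map_minus[OF mods mods lin_homD(1)[OF cross_arr_lin_hom]])
      (use fg XY vwc 3 in \<open>auto intro!: dsum_fst_lin_hom fg_module simp: X.M.minus_eq\<close>)
  moreover have "cross_arr G ((dsum X Y, Y, dsum_snd X Y) # map (\<lambda>Z. (Z, Z, id_map Z)) Zs)
      (v \<ominus>\<^bsub>fobj G (dsum_list (dsum X Y # Zs))\<^esub> w) = \<zero>\<^bsub>fobj G (dsum_list (Y # Zs))\<^esub>"
    by (subst linear_map_minus[OF mods mods lin_homD(1)[OF cross_arr_lin_hom]])
      (use fg XY vwc 3 in \<open>auto intro!: dsum_snd_lin_hom fg_module simp: Y.M.minus_eq\<close>)
  ultimately show ?case using 3 vw XY by simp
qed simp

text \<open>Splitting the first variable adds two kernel conditions to the cross effect at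
  \<open>dsum X Y # Zs\<close>, so it gives a smaller set. The step starts at one variable: the
  convention for no variables is the value at the zero module, which does not bound the cross effect
  in one variable.\<close>

lemma cross_effect_vanishes_Suc:
  assumes "cross_effect_vanishes R G (Suc d)"
  shows "cross_effect_vanishes R G (Suc (Suc d))"
  unfolding cross_effect_vanishes_def
proof (intro allI impI)
  fix Xs :: "('r, 'm) module list"
  assume len: "length Xs = Suc (Suc d)" and fg: "set Xs \<subseteq> fg_projective R"
  then obtain X Y Zs where Xs: "Xs = X # Y # Zs" by (metis length_Suc_conv)
  have "cross_effect G (dsum X Y # Zs) = {\<zero>\<^bsub>fobj G (dsum_list (dsum X Y # Zs))\<^esub>}"
    using assms len fg Xs by (simp add: cross_effect_vanishes_def dsum_fg_projective)
  then have "cross_effect G Xs \<subseteq> {\<zero>\<^bsub>fobj G (dsum_list Xs)\<^esub>}"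
    unfolding Xs by auto
  moreover have "\<zero>\<^bsub>fobj G (dsum_list Xs)\<^esub> \<in> cross_effect G Xs"
    by (rule cross_effect_zero) (use Xs fg in auto)
  ultimately show "cross_effect G Xs = {\<zero>\<^bsub>fobj G (dsum_list Xs)\<^esub>}" by blast
qed

lemma cross_effect_vanishes_mono:
  assumes "cross_effect_vanishes R G d" "0 < d" "d \<le> e"
  shows "cross_effect_vanishes R G e"
  using assms(3,1,2)
proof (induction e rule: dec_induct)
  case (step n)
  then show ?case using cross_effect_vanishes_Suc[of "n - 1"] by simp
qed

text \<open>By monotonicity at most one \<open>d\<close> satisfies \<open>has_degree\<close>, so the
  description in \<open>functor_degree\<close> denotes it. The second hypothesis sets aside the zero
  functor, whose degree does not come from \<open>has_degree\<close>.\<close>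

lemma cross_effect_vanishes_if_degree_less:
  assumes "functor_degree R G < Fin s" "\<exists>M\<in>fg_projective R. carrier (fobj G M) \<noteq> {\<zero>\<^bsub>fobj G M\<^esub>}"
  shows "cross_effect_vanishes R G s"
proof -
  have *: "\<exists>d. has_degree R G d"
    using assms by (auto simp: functor_degree_def split: if_splits)
  then obtain d where d: "has_degree R G d" by blast
  have uniq: "d' \<le> d''" if "has_degree R G d'" "has_degree R G d''" for d' d''
    using that cross_effect_vanishes_mono[of "Suc d''" d'] by (fastforce simp: has_degree_def not_le)
  have "(THE d. has_degree R G d) = d"
    using d uniq by (intro the_equality) (auto intro: antisym)
  then have "d < s" using assms * by (auto simp: functor_degree_def split: if_splits)
  then show ?thesis
    using d cross_effect_vanishes_mono[of "Suc d" s] by (auto simp: has_degree_def)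
qed

text \<open>With \<open>n\<close> more coordinates, each equal to the identity or to zero, this is the alternating sum
  over the \<open>2\<^sup>n\<close> choices of the maps \<open>G (\<phi>, f\<^sub>1, \<dots>, f\<^sub>n)\<close> at \<open>v\<close>.\<close>

fun cross_diff :: "('r, 'm) module \<Rightarrow> 'b \<Rightarrow> ('r, 'm) module \<Rightarrow> ('m \<Rightarrow> 'm) \<Rightarrow> nat \<Rightarrow> 'b" where
  "cross_diff M v X \<phi> 0 = farr G M X \<phi> v"
| "cross_diff M v X \<phi> (Suc n) =
     cross_diff M v (dsum X M) (dsum_pair M \<phi> (id_map M)) n
       \<ominus>\<^bsub>fobj G (dsum_list (X # replicate (Suc n) M))\<^esub>
     cross_diff M v (dsum X M) (dsum_pair M \<phi> (\<lambda>x\<in>carrier M. \<zero>\<^bsub>M\<^esub>)) n"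

section \<open>Membership of the alternating sum in the cross effect\<close>

context
  fixes M :: "('r, 'm) module" and v :: 'b
  assumes M: "M \<in> fg_projective R" and v: "v \<in> carrier (fobj G M)"
begin

lemma dsum_list_replicate_fg: "X \<in> fg_projective R \<Longrightarrow> dsum_list (X # replicate n M) \<in> fg_projective R"
  using M by (intro dsum_list_fg) auto

lemma pair_homs:
  assumes "\<phi> \<in> lin_hom R M X"
  shows "dsum_pair M \<phi> (id_map M) \<in> lin_hom R M (dsum X M)"
    "dsum_pair M \<phi> (\<lambda>x\<in>carrier M. \<zero>\<^bsub>M\<^esub>) \<in> lin_hom R M (dsum X M)"
  using assms by (auto intro!: dsum_pair_lin_hom id_map_lin_hom zero_lin_hom fg_module M)

lemma cross_diff_closed:
  assumes "X \<in> fg_projective R" "\<phi> \<in> lin_hom R M X"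
  shows "cross_diff M v X \<phi> n \<in> carrier (fobj G (dsum_list (X # replicate n M)))"
  using assms
proof (induction n arbitrary: X \<phi>)
  case 0
  then show ?case using lin_homD(3)[OF farr_lin_hom[OF M]] v by simp
next
  case (Suc n)
  interpret D: module R "fobj G (dsum_list (dsum X M # replicate n M))"
    by (rule fobj_module[OF dsum_list_replicate_fg[OF dsum_fg_projective[OF Suc.prems(1) M]]])
  show ?case
    using Suc.IH[OF dsum_fg_projective[OF Suc.prems(1) M] pair_homs(1)[OF Suc.prems(2)]]
      Suc.IH[OF dsum_fg_projective[OF Suc.prems(1) M] pair_homs(2)[OF Suc.prems(2)]]
    by (simp only: cross_diff.simps replicate_Suc dsum_list.simps D.minus_closed)
qed

lemma dsum_map_pair:
  assumes "\<phi> \<in> lin_hom R M X" "g \<in> lin_hom R M M"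
  shows "compose (carrier M) (dsum_map X M h (id_map M)) (dsum_pair M \<phi> g) =
    dsum_pair M (compose (carrier M) h \<phi>) g"
  using lin_homD(3)[OF assms(1)] lin_homD(3)[OF assms(2)]
  by (auto simp: compose_def dsum_pair_def dsum_map_def id_map_def fun_eq_iff)

lemma dsum_fst_pair:
  assumes "\<phi> \<in> lin_hom R M X" "g \<in> lin_hom R M M"
  shows "compose (carrier M) (dsum_fst X M) (dsum_pair M \<phi> g) = \<phi>"
  using lin_homD(2,3)[OF assms(1)] lin_homD(3)[OF assms(2)]
  by (auto simp: compose_def dsum_pair_def dsum_fst_def intro: extensionalityI)

lemma dsum_snd_pair:
  assumes "\<phi> \<in> lin_hom R M X" "g \<in> lin_hom R M M"
  shows "compose (carrier M) (dsum_snd X M) (dsum_pair M \<phi> g) = g"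
  using lin_homD(3)[OF assms(1)] lin_homD(2,3)[OF assms(2)]
  by (auto simp: compose_def dsum_pair_def dsum_snd_def intro: extensionalityI)

lemma cross_arr_replicate:
  assumes "X \<in> fg_projective R" "Y \<in> fg_projective R" "h \<in> lin_hom R X Y"
  shows "cross_arr G ((X, Y, h) # replicate n (M, M, id_map M)) \<in>
    lin_hom R (fobj G (dsum_list (X # replicate n M))) (fobj G (dsum_list (Y # replicate n M)))"
  using cross_arr_lin_hom[OF assms, of "replicate n M"] M by (simp add: map_replicate set_replicate_conv_if)

text \<open>Naturality in the first variable: \<open>h\<close> reaches the innermost map and is
  composed with \<open>\<phi>\<close>, while the later coordinates are untouched. Both projections
  in the definition of the cross effect act in this way.\<close>

lemma cross_arr_cross_diff:
  assumes "X \<in> fg_projective R" "Y \<in> fg_projective R" "h \<in> lin_hom R X Y" "\<phi> \<in> lin_hom R M X"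
  shows "cross_arr G ((X, Y, h) # replicate n (M, M, id_map M)) (cross_diff M v X \<phi> n) =
    cross_diff M v Y (compose (carrier M) h \<phi>) n"
  using assms
proof (induction n arbitrary: X Y h \<phi>)
  case 0
  then show ?case using farr_compose[OF M 0(1,2,4,3) v] by simp
next
  case (Suc n)
  note fg = dsum_fg_projective[OF Suc.prems(1) M] dsum_fg_projective[OF Suc.prems(2) M]
  note h = dsum_map_lin_hom[OF fg_module[OF Suc.prems(1)] fg_module[OF M] Suc.prems(3) id_map_lin_hom[OF fg_module[OF M]]]
  note \<phi> = pair_homs[OF Suc.prems(4)]
  note lin = lin_homD(1)[OF cross_arr_replicate[OF fg h, of n]]
  note IH = Suc.IH[OF fg h]
  note mods = fobj_module[OF dsum_list_replicate_fg]
  have "cross_arr G ((dsum X M, dsum Y M, dsum_map X M h (id_map M)) # replicate n (M, M, id_map M))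
     (cross_diff M v (dsum X M) (dsum_pair M \<phi> (id_map M)) n
       \<ominus>\<^bsub>fobj G (dsum_list (dsum X M # replicate n M))\<^esub>
      cross_diff M v (dsum X M) (dsum_pair M \<phi> (\<lambda>x\<in>carrier M. \<zero>\<^bsub>M\<^esub>)) n) =
    cross_diff M v (dsum Y M) (dsum_pair M (compose (carrier M) h \<phi>) (id_map M)) n
       \<ominus>\<^bsub>fobj G (dsum_list (dsum Y M # replicate n M))\<^esub>
     cross_diff M v (dsum Y M) (dsum_pair M (compose (carrier M) h \<phi>) (\<lambda>x\<in>carrier M. \<zero>\<^bsub>M\<^esub>)) n"
    by (subst linear_map_minus[OF mods[OF fg(1)] mods[OF fg(2)] lin cross_diff_closed[OF fg(1) \<phi>(1)] cross_diff_closed[OF fg(1) \<phi>(2)]])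
      (simp only: IH[OF \<phi>(1)] IH[OF \<phi>(2)] dsum_map_pair[OF Suc.prems(4) id_map_lin_hom[OF fg_module[OF M]]]
        dsum_map_pair[OF Suc.prems(4) zero_lin_hom[OF fg_module[OF M] fg_module[OF M]]])
  then show ?case by simp
qed

text \<open>In the step, each of the two sums is itself a difference over the new coordinate, so the
  induction hypothesis at \<open>dsum X M\<close> places it in the cross effect with one variable
  fewer. What is left is to apply the two projections from \<open>dsum X M\<close>.\<close>

lemma cross_diff_in_cross_effect:
  assumes "X \<in> fg_projective R" "\<phi> \<in> lin_hom R M X" "\<psi> \<in> lin_hom R M X"
  shows "cross_diff M v X \<phi> n \<ominus>\<^bsub>fobj G (dsum_list (X # replicate n M))\<^esub> cross_diff M v X \<psi> n
    \<in> cross_effect G (X # replicate n M)"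
  using assms
proof (induction n arbitrary: X \<phi> \<psi>)
  case 0
  interpret X: module R "fobj G X" by (rule fobj_module) fact
  interpret Z: module R "fobj G zero_module" by (rule fobj_module[OF zero_fg])
  note mX = fg_module[OF 0(1)]
  note z = zero_map_lin_hom[OF mX]
  have vX: "farr G M X \<phi> v \<in> carrier (fobj G X)" "farr G M X \<psi> v \<in> carrier (fobj G X)"
    using lin_homD(3)[OF farr_lin_hom[OF M]] v 0 by auto
  \<comment> \<open>All maps to the zero module agree, so both terms have the same image
    there.\<close>
  have "compose (carrier M) (zero_map X) \<phi> = compose (carrier M) (zero_map X) \<psi>"
    using lin_homD(3)[OF 0(2)] lin_homD(3)[OF 0(3)] by (auto simp: compose_def zero_map_def fun_eq_iff)
  then have "farr G X zero_module (zero_map X) (farr G M X \<phi> v) = farr G X zero_module (zero_map X) (farr G M X \<psi> v)"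
    using farr_compose[OF M 0(1) zero_fg 0(2) z v] farr_compose[OF M 0(1) zero_fg 0(3) z v] by simp
  then have "farr G X zero_module (zero_map X) (farr G M X \<phi> v \<ominus>\<^bsub>fobj G X\<^esub> farr G M X \<psi> v) = \<zero>\<^bsub>fobj G zero_module\<^esub>"
    using lin_homD(3)[OF farr_lin_hom[OF 0(1) zero_fg z]] vX
    by (subst linear_map_minus[OF X.module_axioms Z.module_axioms lin_homD(1)[OF farr_lin_hom[OF 0(1) zero_fg z]]])
      (auto simp: Z.M.minus_eq Z.M.r_neg)
  then show ?case using vX by simp
next
  case (Suc n)
  let ?D = "dsum X M" and ?z = "\<lambda>x\<in>carrier M. \<zero>\<^bsub>M\<^esub>" and ?rep = "replicate n (M, M, id_map M)"
  let ?GD = "fobj G (dsum_list (?D # replicate n M))"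
  note D = dsum_fg_projective[OF Suc.prems(1) M]
  note mX = fg_module[OF Suc.prems(1)] and mM = fg_module[OF M]
  note idz = id_map_lin_hom[OF mM] zero_lin_hom[OF mM mM]
  note mods = fobj_module[OF dsum_list_replicate_fg]
  interpret D: module R ?GD by (rule mods[OF D])
  interpret X: module R "fobj G (dsum_list (X # replicate n M))" by (rule mods) fact
  interpret Y: module R "fobj G (dsum_list (M # replicate n M))" by (rule mods) fact
  note fst = dsum_fst_lin_hom[OF mX mM] and snd = dsum_snd_lin_hom[OF mX mM]
  note lin_fst = lin_homD(1)[OF cross_arr_replicate[OF D Suc.prems(1) fst, of n]]
  note lin_snd = lin_homD(1)[OF cross_arr_replicate[OF D M snd, of n]]
  have cd: "cross_diff M v X \<chi> (Suc n) =
      cross_diff M v ?D (dsum_pair M \<chi> (id_map M)) n \<ominus>\<^bsub>?GD\<^esub> cross_diff M v ?D (dsum_pair M \<chi> ?z) n"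
    for \<chi> by simp
  \<comment> \<open>The first projection forgets the new coordinate and makes the two halves equal.
    The second forgets \<open>\<chi>\<close>; its result need not vanish, but it is the same for
    every \<open>\<chi>\<close>.\<close>
  have step: "cross_diff M v X \<chi> (Suc n) \<in> cross_effect G (?D # replicate n M) \<and>
     cross_arr G ((?D, X, dsum_fst X M) # ?rep) (cross_diff M v X \<chi> (Suc n)) = \<zero>\<^bsub>fobj G (dsum_list (X # replicate n M))\<^esub> \<and>
     cross_arr G ((?D, M, dsum_snd X M) # ?rep) (cross_diff M v X \<chi> (Suc n)) =
       cross_diff M v M (id_map M) n \<ominus>\<^bsub>fobj G (dsum_list (M # replicate n M))\<^esub> cross_diff M v M ?z n"
    if \<chi>: "\<chi> \<in> lin_hom R M X" for \<chi>
  proof (intro conjI)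
    note p = pair_homs[OF \<chi>]
    note cl = cross_diff_closed[OF D p(1), of n] cross_diff_closed[OF D p(2), of n]
    show "cross_diff M v X \<chi> (Suc n) \<in> cross_effect G (?D # replicate n M)"
      unfolding cd by (rule Suc.IH[OF D p])
    show "cross_arr G ((?D, X, dsum_fst X M) # ?rep) (cross_diff M v X \<chi> (Suc n)) = \<zero>\<^bsub>fobj G (dsum_list (X # replicate n M))\<^esub>"
      unfolding cd linear_map_minus[OF D.module_axioms X.module_axioms lin_fst cl]
        cross_arr_cross_diff[OF D Suc.prems(1) fst p(1)] cross_arr_cross_diff[OF D Suc.prems(1) fst p(2)]
        dsum_fst_pair[OF \<chi> idz(1)] dsum_fst_pair[OF \<chi> idz(2)]
      using cross_diff_closed[OF Suc.prems(1) \<chi>, of n] by (simp add: X.M.minus_eq X.M.r_neg)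
    show "cross_arr G ((?D, M, dsum_snd X M) # ?rep) (cross_diff M v X \<chi> (Suc n)) =
       cross_diff M v M (id_map M) n \<ominus>\<^bsub>fobj G (dsum_list (M # replicate n M))\<^esub> cross_diff M v M ?z n"
      unfolding cd linear_map_minus[OF D.module_axioms Y.module_axioms lin_snd cl]
        cross_arr_cross_diff[OF D M snd p(1)] cross_arr_cross_diff[OF D M snd p(2)]
        dsum_snd_pair[OF \<chi> idz(1)] dsum_snd_pair[OF \<chi> idz(2)] ..
  qed
  let ?d = "cross_diff M v X \<phi> (Suc n) \<ominus>\<^bsub>?GD\<^esub> cross_diff M v X \<psi> (Suc n)"
  note s = step[OF Suc.prems(2)] step[OF Suc.prems(3)]
  have cl: "cross_diff M v X \<phi> (Suc n) \<in> carrier ?GD" "cross_diff M v X \<psi> (Suc n) \<in> carrier ?GD"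
    using cross_diff_closed[OF Suc.prems(1,2), of "Suc n"] cross_diff_closed[OF Suc.prems(1,3), of "Suc n"] by simp_all
  have "?d \<in> cross_effect G (?D # replicate n M)"
    using s D M by (intro cross_effect_minus) auto
  moreover have "cross_arr G ((?D, X, dsum_fst X M) # ?rep) ?d = \<zero>\<^bsub>fobj G (dsum_list (X # replicate n M))\<^esub>"
    unfolding linear_map_minus[OF D.module_axioms X.module_axioms lin_fst cl] using s
    by (simp add: X.M.minus_eq del: cross_diff.simps)
  \<comment> \<open>Here the independence of \<open>\<chi>\<close> makes the contributions of
    \<open>\<phi>\<close> and \<open>\<psi>\<close> cancel.\<close>
  moreover have "cross_arr G ((?D, M, dsum_snd X M) # ?rep) ?d = \<zero>\<^bsub>fobj G (dsum_list (M # replicate n M))\<^esub>"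
    unfolding linear_map_minus[OF D.module_axioms Y.module_axioms lin_snd cl]
    using s cross_diff_closed[OF M idz(1), of n] cross_diff_closed[OF M idz(2), of n]
    by (simp add: Y.M.minus_eq Y.M.r_neg del: cross_diff.simps)
  ultimately show ?case
    by (simp add: map_replicate del: cross_diff.simps)
qed

end

text \<open>On the left-bracketed sum this is \<open>h\<close> on \<open>X\<close> plus the identity
  on each copy of \<open>M\<close>; for \<open>X = M\<close> and \<open>h\<close> the identity it is
  the codiagonal.\<close>

fun fold_map :: "('r, 'm) module \<Rightarrow> ('r, 'm) module \<Rightarrow> ('m \<Rightarrow> 'm) \<Rightarrow> nat \<Rightarrow> 'm \<Rightarrow> 'm" where
  "fold_map M X h 0 = h"
| "fold_map M X h (Suc n) = fold_map M (dsum X M) (dsum_copair X M M h (id_map M)) n"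

lemma fold_map_lin_hom:
  assumes "M \<in> fg_projective R" "X \<in> fg_projective R" "h \<in> lin_hom R X M"
  shows "fold_map M X h n \<in> lin_hom R (dsum_list (X # replicate n M)) M"
  using assms(2,3)
proof (induction n arbitrary: X h)
  case (Suc n)
  have "dsum_copair X M M h (id_map M) \<in> lin_hom R (dsum X M) M"
    using Suc.prems assms(1) by (intro dsum_copair_lin_hom id_map_lin_hom fg_module)
  from Suc.IH[OF dsum_fg_projective[OF Suc.prems(1) assms(1)] this] show ?case by simp
qed simp

definition scalar :: "('r, 'm) module \<Rightarrow> int \<Rightarrow> 'm \<Rightarrow> 'm" where
  "scalar M k = (\<lambda>x\<in>carrier M. ([k] \<cdot>\<^bsub>R\<^esub> \<one>\<^bsub>R\<^esub>) \<odot>\<^bsub>M\<^esub> x)"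

text \<open>The invariant is that the coordinates collected so far in \<open>X\<close> fold to the
  scalar \<open>k\<close>. A new identity makes it \<open>k + 1\<close> and a new zero keeps
  \<open>k\<close>, so the recursion of \<open>cross_diff\<close> becomes that of
  \<open>fdiff\<close>.\<close>

lemma fold_map_cross_diff:
  assumes M: "M \<in> fg_projective R" and v: "v \<in> carrier (fobj G M)"
    and homog: "\<And>k. farr G M M (scalar M k) v = ([(k ^ s)] \<cdot>\<^bsub>R\<^esub> \<one>\<^bsub>R\<^esub>) \<odot>\<^bsub>fobj G M\<^esub> v"
    and X: "X \<in> fg_projective R" and \<phi>: "\<phi> \<in> lin_hom R M X" and h: "h \<in> lin_hom R X M"
    and h\<phi>: "compose (carrier M) h \<phi> = scalar M k"
  shows "farr G (dsum_list (X # replicate n M)) M (fold_map M X h n) (cross_diff M v X \<phi> n) =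
    ([(fdiff n (\<lambda>x. x ^ s) k)] \<cdot>\<^bsub>R\<^esub> \<one>\<^bsub>R\<^esub>) \<odot>\<^bsub>fobj G M\<^esub> v"
  using X \<phi> h h\<phi>
proof (induction n arbitrary: X \<phi> h k)
  case 0
  then show ?case using farr_compose[OF M 0(1) M 0(2,3) v] homog[of k] by simp
next
  case (Suc n)
  interpret M: module R M by (rule fg_module[OF M])
  interpret GM: module R "fobj G M" by (rule fobj_module[OF M])
  note D = dsum_fg_projective[OF Suc.prems(1) M]
  let ?D = "dsum X M" and ?h = "dsum_copair X M M h (id_map M)" and ?z = "\<lambda>x\<in>carrier M. \<zero>\<^bsub>M\<^esub>"
  let ?L = "dsum_list (?D # replicate n M)"
  note L = dsum_list_replicate_fg[OF M v D, of n]
  interpret L: module R "fobj G ?L" by (rule fobj_module[OF L])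
  note p = pair_homs[OF M v Suc.prems(2)]
  have h: "?h \<in> lin_hom R ?D M"
    using Suc.prems M by (intro dsum_copair_lin_hom id_map_lin_hom fg_module)
  have hx: "h (\<phi> x) = ([k] \<cdot>\<^bsub>R\<^esub> \<one>\<^bsub>R\<^esub>) \<odot>\<^bsub>M\<^esub> x" if "x \<in> carrier M" for x
    using fun_cong[OF Suc.prems(4), of x] that by (simp add: compose_eq scalar_def)
  have "compose (carrier M) ?h (dsum_pair M \<phi> (id_map M)) = scalar M (k + 1)"
    using lin_homD(3)[OF Suc.prems(2)]
    by (auto simp: compose_def scalar_def fun_eq_iff dsum_copair_def dsum_pair_def id_map_def hx
        R.add.int_pow_mult M.smult_l_distr)
  note IH1 = Suc.IH[OF D p(1) h this]
  have "compose (carrier M) ?h (dsum_pair M \<phi> ?z) = scalar M k"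
    using lin_homD(3)[OF Suc.prems(2)]
    by (auto simp: compose_def scalar_def fun_eq_iff dsum_copair_def dsum_pair_def id_map_def hx)
  note IH2 = Suc.IH[OF D p(2) h this]
  note lin = lin_homD(1)[OF farr_lin_hom[OF L M fold_map_lin_hom[OF M D h]]]
  have "farr G ?L M (fold_map M ?D ?h n)
     (cross_diff M v ?D (dsum_pair M \<phi> (id_map M)) n \<ominus>\<^bsub>fobj G ?L\<^esub> cross_diff M v ?D (dsum_pair M \<phi> ?z) n) =
    ([fdiff (Suc n) (\<lambda>x. x ^ s) k] \<cdot>\<^bsub>R\<^esub> \<one>\<^bsub>R\<^esub>) \<odot>\<^bsub>fobj G M\<^esub> v"
    unfolding linear_map_minus[OF L.module_axioms GM.module_axioms lin
        cross_diff_closed[OF M v D p(1)] cross_diff_closed[OF M v D p(2)]] IH1 IH2 fdiff.simps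
    using v by (simp add: R.add.int_pow_diff GM.smult_l_distr GM.smult_l_minus GM.M.minus_eq)
  then show ?case by simp
qed

lemma factorial_annihilates:
  assumes M: "M \<in> fg_projective R" and v: "v \<in> carrier (fobj G M)"
    and homog: "\<And>k. farr G M M (scalar M k) v = ([(k ^ s)] \<cdot>\<^bsub>R\<^esub> \<one>\<^bsub>R\<^esub>) \<odot>\<^bsub>fobj G M\<^esub> v"
    and s: "0 < s" and vanish: "cross_effect_vanishes R G s"
  shows "[(fact s :: nat)] \<cdot>\<^bsub>fobj G M\<^esub> v = \<zero>\<^bsub>fobj G M\<^esub>"
proof -
  interpret M: module R M by (rule fg_module[OF M])
  interpret GM: module R "fobj G M" by (rule fobj_module[OF M])
  \<comment> \<open>The first variable is already a copy of \<open>M\<close>, so only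
    \<open>s - 1\<close> coordinates are added to it; its own two choices, identity and zero, supply
    the remaining difference.\<close>
  obtain n where n: "s = Suc n" using s by (cases s) auto
  let ?L = "dsum_list (M # replicate n M)" and ?z = "\<lambda>x\<in>carrier M. \<zero>\<^bsub>M\<^esub>"
  note L = dsum_list_replicate_fg[OF M v M, of n]
  interpret L: module R "fobj G ?L" by (rule fobj_module[OF L])
  note idz = id_map_lin_hom[OF M.module_axioms] zero_lin_hom[OF M.module_axioms M.module_axioms]
  have "cross_effect G (M # replicate n M) = {\<zero>\<^bsub>fobj G ?L\<^esub>}"
    using vanish M unfolding cross_effect_vanishes_def n by (simp add: set_replicate_conv_if)
  then have zero: "cross_diff M v M (id_map M) n \<ominus>\<^bsub>fobj G ?L\<^esub> cross_diff M v M ?z n = \<zero>\<^bsub>fobj G ?L\<^esub>"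
    using cross_diff_in_cross_effect[OF M v M idz, of n] by simp
  note lin = lin_homD(1)[OF farr_lin_hom[OF L M fold_map_lin_hom[OF M M idz(1)]]]
  \<comment> \<open>The starting values \<open>k = 1\<close> and \<open>k = 0\<close> of the
    invariant for these two choices.\<close>
  have sc: "compose (carrier M) (id_map M) (id_map M) = scalar M 1" "compose (carrier M) (id_map M) ?z = scalar M 0"
    by (auto simp: compose_def id_map_def scalar_def fun_eq_iff add_pow_def[of _ "0 :: int"])
  have "\<zero>\<^bsub>fobj G M\<^esub> = farr G ?L M (fold_map M M (id_map M) n)
    (cross_diff M v M (id_map M) n \<ominus>\<^bsub>fobj G ?L\<^esub> cross_diff M v M ?z n)"
    unfolding zero by (rule linear_map_zero[OF L.module_axioms GM.module_axioms lin, symmetric])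
  also have "\<dots> = ([fdiff n (\<lambda>x. x ^ s) 1] \<cdot>\<^bsub>R\<^esub> \<one>\<^bsub>R\<^esub>) \<odot>\<^bsub>fobj G M\<^esub> v
      \<ominus>\<^bsub>fobj G M\<^esub> ([fdiff n (\<lambda>x. x ^ s) 0] \<cdot>\<^bsub>R\<^esub> \<one>\<^bsub>R\<^esub>) \<odot>\<^bsub>fobj G M\<^esub> v"
    unfolding linear_map_minus[OF L.module_axioms GM.module_axioms lin
        cross_diff_closed[OF M v M idz(1)] cross_diff_closed[OF M v M idz(2)]]
      fold_map_cross_diff[OF M v homog M idz(1) idz(1) sc(1)]
      fold_map_cross_diff[OF M v homog M idz(2) idz(1) sc(2)] ..
  \<comment> \<open>The differences of order \<open>n\<close> at 1 and at 0 combine into the one of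
    order \<open>s\<close> at 0.\<close>
  also have "\<dots> = ([fdiff (Suc n) (\<lambda>x. x ^ s) 0] \<cdot>\<^bsub>R\<^esub> \<one>\<^bsub>R\<^esub>) \<odot>\<^bsub>fobj G M\<^esub> v"
    using v by (simp add: R.add.int_pow_diff GM.smult_l_distr GM.smult_l_minus GM.M.minus_eq)
  also have "fdiff (Suc n) (\<lambda>x. x ^ s) 0 = int (fact s)"
    unfolding n by (simp only: fdiff_power[OF order_refl] if_True refl of_nat_fact)
  finally show ?thesis using GM.add_pow_one_smult[OF v, of "fact s"] by simp
qed

end

section \<open>From strict polynomial functors to ordinary ones\<close>

lemma underlying_projective_functor:
  fixes F :: "('r, 'm, 'b) schur_functor" and c :: "'m \<times> 'm \<Rightarrow> 'm"
  assumes "paired_universe R c" and F: "strict_polynomial_functor R s F"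
  shows "projective_functor R c (underlying_functor R s F)"
proof -
  interpret paired_universe R c by fact
  interpret F: strict_polynomial_functor R s F by fact
  have tm: "tensor_map R s M N f \<in> schur_hom R s M N"
    if "M \<in> fg_projective R" "N \<in> fg_projective R" "f \<in> lin_hom R M N" for M N :: "('r, 'm) module" and f
  proof -
    interpret M: linear_module R M
      by (rule linear_module.intro) (use that in \<open>simp add: fg_projective_def\<close>)
    show ?thesis by (rule M.tensor_map_schur_hom) (use that in \<open>auto simp: fg_projective_def\<close>)
  qed
  have farr: "farr F M N g \<in> lin_hom R (fobj F M) (fobj F N)"
    if "M \<in> fg_projective R" "N \<in> fg_projective R" "g \<in> schur_hom R s M N" for M N :: "('r, 'm) module" and g
    using linear_mapD(1)[OF F.farr_linear[OF that(1,2)]] that(3)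
    by (simp add: schur_hom_module_def hom_module_def)
  show ?thesis
  proof (intro projective_functor.intro projective_functor_axioms.intro assms(1), goal_cases)
    case (1 M)
    then show ?case by (simp add: underlying_functor_def F.fobj_module)
  next
    case (2 M N f)
    then show ?case by (simp add: underlying_functor_def farr tm)
  next
    case (3 M N P f g v)
    interpret M: linear_module R M
      by (rule linear_module.intro) (use 3 in \<open>simp add: fg_projective_def\<close>)
    have "tensor_map R s M P (compose (carrier M) g f) =
      compose (carrier (tensor_power R s M)) (tensor_map R s N P g) (tensor_map R s M N f)"
      by (rule M.tensor_map_compose) (use 3 in \<open>auto simp: fg_projective_def\<close>)
    then show ?case
      using 3 by (simp add: underlying_functor_def F.farr_comp tm compose_eq)
  qed
qed

text \<open>On the tensor power \<open>r\<close> induces a multiple of the identity, and a functor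
  that is linear on Schur morphisms sends it to the same multiple of the identity of the
  value.\<close>

lemma underlying_functor_homogeneous:
  fixes F :: "('r, 'm, 'b) schur_functor"
  assumes F: "strict_polynomial_functor R s F" and M: "M \<in> fg_projective R"
    and r: "r \<in> carrier R" and v: "v \<in> carrier (fobj F M)"
  shows "farr (underlying_functor R s F) M M (\<lambda>x\<in>carrier M. r \<odot>\<^bsub>M\<^esub> x) v = (r [^]\<^bsub>R\<^esub> s) \<odot>\<^bsub>fobj F M\<^esub> v"
proof -
  interpret F: strict_polynomial_functor R s F by fact
  interpret M: linear_module R M
    by (rule linear_module.intro) (use M in \<open>simp add: fg_projective_def\<close>)
  let ?T = "tensor_power R s M" and ?H = "schur_hom_module R s M M"
  \<comment> \<open>Linearity of \<open>farr\<close> is available on equivariant maps; the identity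
    is one, being induced by the identity of \<open>M\<close>.\<close>
  have "id_map ?T \<in> schur_hom R s M M"
    using M.tensor_map_schur_hom[OF M.module_axioms id_map_lin_hom[OF M.module_axioms]]
    by (simp add: M.tensor_map_id)
  then have id: "id_map ?T \<in> carrier ?H" by (simp add: schur_hom_module_def)
  have "tensor_map R s M M (\<lambda>x\<in>carrier M. r \<odot>\<^bsub>M\<^esub> x) = (r [^]\<^bsub>R\<^esub> s) \<odot>\<^bsub>?H\<^esub> id_map ?T"
    by (simp add: M.tensor_map_smult[OF r] schur_hom_module_def hom_module_def id_map_def cong: restrict_cong)
  then have "farr (underlying_functor R s F) M M (\<lambda>x\<in>carrier M. r \<odot>\<^bsub>M\<^esub> x) =
    (r [^]\<^bsub>R\<^esub> s) \<odot>\<^bsub>hom_module R (fobj F M) (fobj F M)\<^esub> id_map (fobj F M)"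
    using linear_mapD(3)[OF F.farr_linear[OF M M] M.R.nat_pow_closed[OF r] id] F.farr_id[OF M]
    by (simp add: underlying_functor_def)
  then show ?thesis using v by (simp add: hom_module_def id_map_def)
qed

theorem proposition1p1:
  fixes R :: "('r, 'x) ring_scheme"
    and s :: nat
    and F :: "('r, 'm, 'b) schur_functor"
    and pairing :: "'m \<times> 'm \<Rightarrow> 'm"
    and embedding :: "'r \<Rightarrow> 'm"
    and M :: "('r, 'm) module"
  assumes "inj pairing" and "inj_on embedding (carrier R)"
    and "cring R"
    and "0 < s"
    and "strict_polynomial_functor R s F"
    and "strict_degree R s F < Fin s"
    and "M \<in> fg_projective R"
  shows "torsion_group (add_monoid (fobj F M))"
proof -
  let ?G = "underlying_functor R s F"
  have "paired_universe R pairing"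
    using assms(3,1) by (rule paired_universe.intro)
  then interpret G: projective_functor R pairing ?G
    using assms(5) by (rule underlying_projective_functor)
  have fobj: "fobj ?G = fobj F" by (simp add: underlying_functor_def)
  interpret FM: module R "fobj F M"
    using G.fobj_module[OF assms(7)] by (simp add: fobj)
  have "\<exists>n>0. [(n :: nat)] \<cdot>\<^bsub>fobj F M\<^esub> v = \<zero>\<^bsub>fobj F M\<^esub>" if v: "v \<in> carrier (fobj F M)" for v
  proof (cases "\<forall>N\<in>fg_projective R. carrier (fobj ?G N) = {\<zero>\<^bsub>fobj ?G N\<^esub>}")
    \<comment> \<open>The zero functor has degree minus infinity, outside the reach of
      \<open>cross_effect_vanishes_if_degree_less\<close>; as its values are zero,
      \<open>n = 1\<close> serves.\<close>
    case True
    then have "v = \<zero>\<^bsub>fobj F M\<^esub>" using v assms(7) by (auto simp: fobj)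
    then show ?thesis by (intro exI[of _ 1]) simp
  next
    case False
    then have vanish: "cross_effect_vanishes R ?G s"
      using assms(6) unfolding strict_degree_def by (intro G.cross_effect_vanishes_if_degree_less) auto
    have "[(fact s :: nat)] \<cdot>\<^bsub>fobj ?G M\<^esub> v = \<zero>\<^bsub>fobj ?G M\<^esub>"
    proof (rule G.factorial_annihilates[OF assms(7) _ _ assms(4) vanish])
      show "v \<in> carrier (fobj ?G M)" using v by (simp add: fobj)
      \<comment> \<open>Homogeneity is applied to the image of \<open>k\<close> in \<open>R\<close>,
        whose \<open>s\<close>-th power is the image of \<open>k ^ s\<close>.\<close>
      show "farr ?G M M (G.scalar M k) v = ([(k ^ s)] \<cdot>\<^bsub>R\<^esub> \<one>\<^bsub>R\<^esub>) \<odot>\<^bsub>fobj ?G M\<^esub> v" for k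
        unfolding G.scalar_def fobj
        by (subst underlying_functor_homogeneous[OF assms(5,7) _ v])
          (simp_all add: G.R.add_pow_one_power)
    qed
    then show ?thesis by (intro exI[of _ "fact s"]) (simp add: fobj)
  qed
  \<comment> \<open>Multiples in the module are by definition powers in its additive monoid, the
    form in which torsion is stated.\<close>
  then show ?thesis
    by (auto simp: torsion_group_def FM.M.add.is_group add_pow_def)
qed

end
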